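(* For every stably structured category $(\mathcal C,\mathcal S)$, the partial map category $\mathsf{Par}(\mathcal C,\mathcal S)$ is isomorphic to the partial map category $\mathsf{Par}(\mathsf{Total}(\mathsf{Par}(\mathcal C,\mathcal S)),\mathcal I_{\mathcal C,\mathcal S})$ of the stably structured category $(\mathsf{Total}(\mathsf{Par}(\mathcal C,\mathcal S)),\mathcal I_{\mathcal C,\mathcal S})$, where $\mathcal I_{\mathcal C,\mathcal S}=\mathsf{ReIso}(\mathsf{Par}(\mathcal C,\mathcal S))$.
   Context: A stably structured category is a pair $(\mathcal C,\mathcal S)$ with $\mathcal C$ a category and $\mathcal S$ a class of morphisms of $\mathcal C$ that contains all isomorphisms, is closed under composition, and is such that pullbacks of $\mathcal S$-morphisms along arbitrary morphisms exist in $\mathcal C$ and belong to $\mathcal S$. Restriction categories: a restriction structure on a category assigns to each $f:A\to B$ a morphism $\bar f:A\to A$ such that (R1) $f\cdot\bar f=f$; (R2) $\bar f\cdot\bar g=\bar g\cdot\bar f$ if $\mathrm{dom}f=\mathrm{dom}g$; (R3) $\overline{g\cdot\bar f}=\bar g\cdot\bar f$ if $\mathrm{dom}f=\mathrm{dom}g$; (R4) $\bar g\cdot f=f\cdot\overline{g\cdot f}$ if $\mathrm{cod}f=\mathrm{dom}g$. It is split if every $e$ with $\bar e=e$ splits ($e=m\cdot r$, $r\cdot m=1$ for some $m,r$). A morphism $f$ is total if $\bar f=1$; $i$ is a restricted isomorphism if there is a (necessarily unique) $i^-$ with $i^-\cdot i=\bar i$, $i\cdot i^-=\overline{i^-}$.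 For a split restriction category $\mathcal X$, $\mathsf{Total}(\mathcal X)$ is the subcategory of total morphisms (all objects) and $\mathsf{ReIso}(\mathcal X)$ is the class of restricted isomorphisms in $\mathcal X$ that are total; $(\mathsf{Total}(\mathcal X),\mathsf{ReIso}(\mathcal X))$ is a stably structured category. $\mathsf{Par}(\mathcal C,\mathcal S)$: an $\mathcal S$-span $(s,f):A\to B$ is a pair $s:D\to A$ in $\mathcal S$, $f:D\to B$ in $\mathcal C$; a morphism $x:(s,f)\to(\tilde s,\tilde f)$ is a $\mathcal C$-morphism with $\tilde s\cdot x=s$, $\tilde f\cdot x=f$; isomorphic spans are identified; they form the category $\mathsf{Span}(\mathcal C,\mathcal S)$ (with the objects of $\mathcal C$) under $(t,g)\cdot(s,f)=(s\cdot t',g\cdot f')$, where $f\cdot t'=t\cdot f'$ is a pullback square. An $\mathcal S$-cospan $\langle f,s\rangle:A\to B$ is a pair $f:A\to D$ in $\mathcal C$, $s:B\to D$ in $\mathcal S$; a morphism $v:\langle f,s\rangle\to\langle g,t\rangle$ is a $\mathcal C$-morphism with $v\cdot f=g$, $v\cdot s=t$; with pullback squares $f\cdot s'=s\cdot f'$ and $g\cdot t'=t\cdot g'$, its conjugate $v^\star$ is the unique morphism with $t'\cdot v^\star=s'$, $g'\cdot v^\star=f'$. $\mathcal S^\star$ is the class of all existing pullbacks in $\mathcal C$ of conjugates $v^\star$ of $\mathcal S$-cospan morphisms $v$ with $v\in\mathcal S$. $\sim_{\mathrm z^\star}$ is the least equivalence relation on $\mathcal S$-spans such that $(s,f)\sim_{\mathrm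 z^\star}(\tilde s,\tilde f)$ whenever there is a morphism $x:(s,f)\to(\tilde s,\tilde f)$ with $x\in\mathcal S^\star$ (a congruence). $\mathsf{Par}(\mathcal C,\mathcal S)$ is the quotient of $\mathsf{Span}(\mathcal C,\mathcal S)$ by $\sim_{\mathrm z^\star}$, a split restriction category with $\overline{[s,f]_{\mathrm z^\star}}=[s,s]_{\mathrm z^\star}$. *)

theory Defs
  imports Main
begin

record ('o, 'm) cat =
  Obj :: "'o set"
  Arr :: "'m set"
  Dom :: "'m \<Rightarrow> 'o"
  Cod :: "'m \<Rightarrow> 'o"
  Ide :: "'o \<Rightarrow> 'm"
  Comp :: "'m \<Rightarrow> 'm \<Rightarrow> 'm"  (infixl "\<cdot>\<index>" 70)

text \<open>\<open>g \<cdot>\<^bsub>C\<^esub> f\<close> means first \<open>f\<close>, then \<open>g\<close>; nothing is assumed about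
  the operations outside \<open>Obj C\<close>, \<open>Arr C\<close> and composable pairs.\<close>

definition Hom :: "('o, 'm, 'x) cat_scheme \<Rightarrow> 'o \<Rightarrow> 'o \<Rightarrow> 'm set" where
  "Hom C A B = {f \<in> Arr C. Dom C f = A \<and> Cod C f = B}"

locale category =
  fixes C :: "('o, 'm, 'x) cat_scheme" (structure)
  assumes Dom_in_Obj: "f \<in> Arr C \<Longrightarrow> Dom C f \<in> Obj C"
    and Cod_in_Obj: "f \<in> Arr C \<Longrightarrow> Cod C f \<in> Obj C"
    and Id_in_hom: "A \<in> Obj C \<Longrightarrow> Ide C A \<in> Hom C A A"
    and Comp_in_hom:
      "\<lbrakk>f \<in> Arr C; g \<in> Arr C; Cod C f = Dom C g\<rbrakk> \<Longrightarrow> g \<cdot> f \<in> Hom C (Dom C f) (Cod C g)"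
    and Comp_Id: "f \<in> Arr C \<Longrightarrow> f \<cdot> Ide C (Dom C f) = f"
    and Id_Comp: "f \<in> Arr C \<Longrightarrow> Ide C (Cod C f) \<cdot> f = f"
    and Comp_assoc:
      "\<lbrakk>f \<in> Arr C; g \<in> Arr C; h \<in> Arr C; Cod C f = Dom C g; Cod C g = Dom C h\<rbrakk>
        \<Longrightarrow> (h \<cdot> g) \<cdot> f = h \<cdot> (g \<cdot> f)"

definition is_iso :: "('o, 'm, 'x) cat_scheme \<Rightarrow> 'm \<Rightarrow> bool" where
  "is_iso C f \<longleftrightarrow> f \<in> Arr C \<and>
    (\<exists>g \<in> Hom C (Cod C f) (Dom C f).
       g \<cdot>\<^bsub>C\<^esub> f = Ide C (Dom C f) \<and> f \<cdot>\<^bsub>C\<^esub> g = Ide C (Cod C f))"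

text \<open>\<open>is_pullback C f s s' f'\<close>: the square \<open>f \<cdot> s' = s \<cdot> f'\<close> is a pullback; thus \<open>s'\<close>
  is the pullback of \<open>s\<close> along \<open>f\<close>, and \<open>f'\<close> the pullback of \<open>f\<close> along \<open>s\<close>.\<close>

definition is_pullback ::
    "('o, 'm, 'x) cat_scheme \<Rightarrow> 'm \<Rightarrow> 'm \<Rightarrow> 'm \<Rightarrow> 'm \<Rightarrow> bool" where
  "is_pullback C f s s' f' \<longleftrightarrow>
     f \<in> Arr C \<and> s \<in> Arr C \<and> s' \<in> Arr C \<and> f' \<in> Arr C \<and>
     Cod C f = Cod C s \<and> Dom C s' = Dom C f' \<and> Cod C s' = Dom C f \<and> Cod C f' = Dom C s \<and>
     f \<cdot>\<^bsub>C\<^esub> s' = s \<cdot>\<^bsub>C\<^esub> f' \<and>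
     (\<forall>a \<in> Arr C. \<forall>b \<in> Arr C.
        Dom C a = Dom C b \<and> Cod C a = Dom C f \<and> Cod C b = Dom C s \<and>
        f \<cdot>\<^bsub>C\<^esub> a = s \<cdot>\<^bsub>C\<^esub> b \<longrightarrow>
        (\<exists>!u. u \<in> Hom C (Dom C a) (Dom C s') \<and> s' \<cdot>\<^bsub>C\<^esub> u = a \<and> f' \<cdot>\<^bsub>C\<^esub> u = b))"

locale stably_structured = category C for C :: "('o, 'm, 'x) cat_scheme" (structure) +
  fixes S :: "'m set"
  assumes S_subset: "S \<subseteq> Arr C"
    and iso_in_S: "is_iso C f \<Longrightarrow> f \<in> S"
    and Comp_in_S: "\<lbrakk>s \<in> S; t \<in> S; Cod C s = Dom C t\<rbrakk> \<Longrightarrow> t \<cdot> s \<in> S"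
    and pullback_exists:
      "\<lbrakk>s \<in> S; f \<in> Arr C; Cod C f = Cod C s\<rbrakk> \<Longrightarrow> \<exists>s' f'. is_pullback C f s s' f'"
    and pullback_in_S: "\<lbrakk>s \<in> S; is_pullback C f s s' f'\<rbrakk> \<Longrightarrow> s' \<in> S"

record ('o, 'm) rcat = "('o, 'm) cat" +
  Rst :: "'m \<Rightarrow> 'm"

locale restriction_category = category X for X :: "('o, 'm, 'x) rcat_scheme" (structure) +
  assumes Rst_in_hom: "f \<in> Arr X \<Longrightarrow> Rst X f \<in> Hom X (Dom X f) (Dom X f)"
    and R1: "f \<in> Arr X \<Longrightarrow> f \<cdot> Rst X f = f"
    and R2: "\<lbrakk>f \<in> Arr X; g \<in> Arr X; Dom X f = Dom X g\<rbrakk>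
      \<Longrightarrow> Rst X f \<cdot> Rst X g = Rst X g \<cdot> Rst X f"
    and R3: "\<lbrakk>f \<in> Arr X; g \<in> Arr X; Dom X f = Dom X g\<rbrakk>
      \<Longrightarrow> Rst X (g \<cdot> Rst X f) = Rst X g \<cdot> Rst X f"
    and R4: "\<lbrakk>f \<in> Arr X; g \<in> Arr X; Cod X f = Dom X g\<rbrakk>
      \<Longrightarrow> Rst X g \<cdot> f = f \<cdot> Rst X (g \<cdot> f)"

definition is_total :: "('o, 'm, 'x) rcat_scheme \<Rightarrow> 'm \<Rightarrow> bool" where
  "is_total X f \<longleftrightarrow> f \<in> Arr X \<and> Rst X f = Ide X (Dom X f)"

definition is_restricted_iso :: "('o, 'm, 'x) rcat_scheme \<Rightarrow> 'm \<Rightarrow> bool" where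
  "is_restricted_iso X i \<longleftrightarrow> i \<in> Arr X \<and>
    (\<exists>j \<in> Hom X (Cod X i) (Dom X i). j \<cdot>\<^bsub>X\<^esub> i = Rst X i \<and> i \<cdot>\<^bsub>X\<^esub> j = Rst X j)"

definition Total_cat :: "('o, 'm, 'x) rcat_scheme \<Rightarrow> ('o, 'm) cat" where
  "Total_cat X = \<lparr>Obj = Obj X, Arr = {f. is_total X f}, Dom = Dom X, Cod = Cod X,
     Ide = Ide X, Comp = Comp X\<rparr>"

definition ReIso :: "('o, 'm, 'x) rcat_scheme \<Rightarrow> 'm set" where
  "ReIso X = {i. is_restricted_iso X i \<and> is_total X i}"

definition spans ::
    "('o, 'm, 'x) cat_scheme \<Rightarrow> 'm set \<Rightarrow> 'o \<Rightarrow> 'o \<Rightarrow> ('m \<times> 'm) set" where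
  "spans C S A B = {(s, f). s \<in> S \<and> s \<in> Arr C \<and> f \<in> Arr C \<and> Dom C s = Dom C f \<and>
     Cod C s = A \<and> Cod C f = B}"

definition span_mor ::
    "('o, 'm, 'x) cat_scheme \<Rightarrow> 'm \<Rightarrow> 'm \<times> 'm \<Rightarrow> 'm \<times> 'm \<Rightarrow> bool" where
  "span_mor C x = (\<lambda>(s, f) (s1, f1).
     x \<in> Hom C (Dom C s) (Dom C s1) \<and> s1 \<cdot>\<^bsub>C\<^esub> x = s \<and> f1 \<cdot>\<^bsub>C\<^esub> x = f)"

definition cospans ::
    "('o, 'm, 'x) cat_scheme \<Rightarrow> 'm set \<Rightarrow> 'o \<Rightarrow> 'o \<Rightarrow> ('m \<times> 'm) set" where
  "cospans C S A B = {(f, s). f \<in> Arr C \<and> s \<in> S \<and> s \<in> Arr C \<and> Cod C f = Cod C s \<and>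
     Dom C f = A \<and> Dom C s = B}"

definition cospan_mor ::
    "('o, 'm, 'x) cat_scheme \<Rightarrow> 'm \<Rightarrow> 'm \<times> 'm \<Rightarrow> 'm \<times> 'm \<Rightarrow> bool" where
  "cospan_mor C v = (\<lambda>(f, s) (g, t).
     v \<in> Hom C (Cod C s) (Cod C t) \<and> v \<cdot>\<^bsub>C\<^esub> f = g \<and> v \<cdot>\<^bsub>C\<^esub> s = t)"

text \<open>Conjugates are determined only up to the choice of the two pullbacks; all choices are
  admitted.\<close>

definition is_conjugate ::
    "('o, 'm, 'x) cat_scheme \<Rightarrow> 'm \<times> 'm \<Rightarrow> 'm \<times> 'm \<Rightarrow> 'm \<Rightarrow> bool" where
  "is_conjugate C = (\<lambda>(f, s) (g, t) w.
     \<exists>s' f' t' g'. is_pullback C f s s' f' \<and> is_pullback C g t t' g' \<and>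
       w \<in> Hom C (Dom C s') (Dom C t') \<and> t' \<cdot>\<^bsub>C\<^esub> w = s' \<and> g' \<cdot>\<^bsub>C\<^esub> w = f')"

definition S_star :: "('o, 'm, 'x) cat_scheme \<Rightarrow> 'm set \<Rightarrow> 'm set" where
  "S_star C S = {x. \<exists>A B c d v w h y.
     c \<in> cospans C S A B \<and> d \<in> cospans C S A B \<and> cospan_mor C v c d \<and> v \<in> S \<and>
     is_conjugate C c d w \<and> is_pullback C h w x y}"

text \<open>Generating the equivalence by isomorphisms as well as by \<open>S_star\<close> performs in one step the
  identification of isomorphic spans and the quotient by the \<open>S_star\<close>-equivalence.
  (\<^const>\<open>equivclp\<close> relates a pair that is not a span only to itself.)\<close>

definition span_step ::
    "('o, 'm, 'x) cat_scheme \<Rightarrow> 'm set \<Rightarrow> 'm \<times> 'm \<Rightarrow> 'm \<times> 'm \<Rightarrow> bool" where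
  "span_step C S p q \<longleftrightarrow> (\<exists>A B x. p \<in> spans C S A B \<and> q \<in> spans C S A B \<and>
     span_mor C x p q \<and> (is_iso C x \<or> x \<in> S_star C S))"

definition span_class ::
    "('o, 'm, 'x) cat_scheme \<Rightarrow> 'm set \<Rightarrow> 'm \<times> 'm \<Rightarrow> ('m \<times> 'm) set" where
  "span_class C S p = {q. equivclp (span_step C S) p q}"

text \<open>Composition and restriction take the union over all representatives (and all pullback
  squares) of the class of the result, so that no choices enter.\<close>

definition Par :: "('o, 'm, 'x) cat_scheme \<Rightarrow> 'm set
    \<Rightarrow> ('o, 'o \<times> 'o \<times> ('m \<times> 'm) set) rcat" where
  "Par C S = \<lparr>
     Obj = Obj C,
     Arr = {(A, B, span_class C S p) | A B p. p \<in> spans C S A B},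
     Dom = (\<lambda>(A, B, X). A),
     Cod = (\<lambda>(A, B, X). B),
     Ide = (\<lambda>A. (A, A, span_class C S (Ide C A, Ide C A))),
     Comp = (\<lambda>(B1, D, Y) (A, B, X).
       (A, D, \<Union> {span_class C S (s \<cdot>\<^bsub>C\<^esub> t', g \<cdot>\<^bsub>C\<^esub> f') | s f t g t' f'.
                (s, f) \<in> X \<and> (t, g) \<in> Y \<and> is_pullback C f t t' f'})),
     Rst = (\<lambda>(A, B, X). (A, A, \<Union> {span_class C S (s, s) | s f. (s, f) \<in> X}))\<rparr>"

locale restriction_functor =
  dom: restriction_category X + cod: restriction_category Y
  for X :: "('o, 'm, 'x) rcat_scheme" and Y :: "('p, 'n, 'y) rcat_scheme" +
  fixes F0 :: "'o \<Rightarrow> 'p" and F1 :: "'m \<Rightarrow> 'n"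
  assumes F0_Obj: "A \<in> Obj X \<Longrightarrow> F0 A \<in> Obj Y"
    and F1_hom: "f \<in> Arr X \<Longrightarrow> F1 f \<in> Hom Y (F0 (Dom X f)) (F0 (Cod X f))"
    and F1_Id: "A \<in> Obj X \<Longrightarrow> F1 (Ide X A) = Ide Y (F0 A)"
    and F1_Comp: "\<lbrakk>f \<in> Arr X; g \<in> Arr X; Cod X f = Dom X g\<rbrakk>
      \<Longrightarrow> F1 (g \<cdot>\<^bsub>X\<^esub> f) = F1 g \<cdot>\<^bsub>Y\<^esub> F1 f"
    and F1_Rst: "f \<in> Arr X \<Longrightarrow> F1 (Rst X f) = Rst Y (F1 f)"

definition rcat_isomorphic ::
    "('o, 'm, 'x) rcat_scheme \<Rightarrow> ('p, 'n, 'y) rcat_scheme \<Rightarrow> bool" where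
  "rcat_isomorphic X Y \<longleftrightarrow> (\<exists>F0 F1 G0 G1.
     restriction_functor X Y F0 F1 \<and> restriction_functor Y X G0 G1 \<and>
     (\<forall>A \<in> Obj X. G0 (F0 A) = A) \<and> (\<forall>f \<in> Arr X. G1 (F1 f) = f) \<and>
     (\<forall>B \<in> Obj Y. F0 (G0 B) = B) \<and> (\<forall>g \<in> Arr Y. F1 (G1 g) = g))"

end

theory Submission
  imports Defs
begin

text \<open>Every partial map factors as \<open>[s, f] = F f \<cdot> R s\<close> with \<open>F f = [1, f]\<close> and \<open>R s = [s, 1]\<close>. The
  diagonal of the kernel pair of \<open>s \<in> \<S>\<close> is the conjugate of the cospan morphism
  \<open>s : \<langle>1, 1\<rangle> \<rightarrow> \<langle>s, s\<rangle>\<close>, so \<open>R s \<cdot> F s = 1\<close>. This equation and the pullback description of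
  composition give the restriction axioms, and also the splitting \<open>[s, s] = F s \<cdot> R s\<close>.

  For any split restriction category \<open>X\<close> the assignment \<open>[s, f] \<mapsto> f \<cdot> s\<^sup>-\<close> is an isomorphism from the
  partial maps of total maps with respect to total restricted isomorphisms to \<open>X\<close>: these are
  monic, so there spans are identified only up to isomorphism, and splitting the restriction of a
  morphism recovers its span. The pullback of \<open>s\<close> along a total \<open>f\<close> is the monic part of a
  splitting of the restriction of \<open>s\<^sup>- \<cdot> f\<close>. The theorem is the case where \<open>X\<close> is the category of
  partial maps itself.\<close>

section \<open>Pullbacks\<close>

context category
begin

lemma Comp_simps [simp]:
  assumes "f \<in> Arr C" "g \<in> Arr C" "Cod C f = Dom C g"
  shows "g \<cdot> f \<in> Arr C" "Dom C (g \<cdot> f) = Dom C f" "Cod C (g \<cdot> f) = Cod C g"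
  using Comp_in_hom[OF assms] by (auto simp: Hom_def)

lemma Ide_simps [simp]:
  assumes "A \<in> Obj C"
  shows "Ide C A \<in> Arr C" "Dom C (Ide C A) = A" "Cod C (Ide C A) = A"
  using Id_in_hom[OF assms] by (auto simp: Hom_def)

declare Dom_in_Obj [simp] Cod_in_Obj [simp] Comp_assoc [simp]

lemma Comp_Ide [simp]: "f \<in> Arr C \<Longrightarrow> Dom C f = A \<Longrightarrow> f \<cdot> Ide C A = f"
  using Comp_Id by auto

lemma Ide_Comp [simp]: "f \<in> Arr C \<Longrightarrow> Cod C f = A \<Longrightarrow> Ide C A \<cdot> f = f"
  using Id_Comp by auto

text \<open>The simplifier brackets composites to the right, which hides a known composite
  \<open>g \<cdot> f\<close> when another factor \<open>h\<close> comes first. This form applies the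
  equation inside a right-nested composite.\<close>

lemma Comp_reassoc:
  assumes "g \<cdot> f = k" "f \<in> Arr C" "g \<in> Arr C" "h \<in> Arr C" "Cod C f = Dom C g" "Cod C h = Dom C f"
  shows "g \<cdot> (f \<cdot> h) = k \<cdot> h"
  using assms Comp_assoc by metis

lemma is_isoI:
  assumes "f \<in> Arr C" "g \<in> Arr C" "Dom C g = Cod C f" "Cod C g = Dom C f"
    "g \<cdot> f = Ide C (Dom C f)" "f \<cdot> g = Ide C (Cod C f)"
  shows "is_iso C f"
  using assms unfolding is_iso_def Hom_def by blast

lemma is_isoE:
  assumes "is_iso C f"
  obtains g where "f \<in> Arr C" "g \<in> Arr C" "Dom C g = Cod C f" "Cod C g = Dom C f"
    "g \<cdot> f = Ide C (Dom C f)" "f \<cdot> g = Ide C (Cod C f)"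
  using assms unfolding is_iso_def Hom_def by blast

lemma is_iso_Ide: "A \<in> Obj C \<Longrightarrow> is_iso C (Ide C A)"
  by (rule is_isoI[of _ "Ide C A"]) auto

section \<open>Pullback squares: universal property, pasting, isomorphisms\<close>

lemma is_pullbackD:
  assumes "is_pullback C f s s' f'"
  shows "f \<in> Arr C" "s \<in> Arr C" "s' \<in> Arr C" "f' \<in> Arr C"
    "Cod C f = Cod C s" "Dom C s' = Dom C f'" "Cod C s' = Dom C f" "Cod C f' = Dom C s"
    "f \<cdot> s' = s \<cdot> f'"
  using assms unfolding is_pullback_def by blast+

lemma is_pullback_ex1:
  assumes "is_pullback C f s s' f'" "a \<in> Arr C" "b \<in> Arr C"
    "Dom C a = Dom C b" "Cod C a = Dom C f" "Cod C b = Dom C s" "f \<cdot> a = s \<cdot> b"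
  shows "\<exists>!u. u \<in> Hom C (Dom C a) (Dom C s') \<and> s' \<cdot> u = a \<and> f' \<cdot> u = b"
  using assms unfolding is_pullback_def by blast

lemma is_pullback_lift:
  assumes "is_pullback C f s s' f'" "a \<in> Arr C" "b \<in> Arr C"
    "Dom C a = Dom C b" "Cod C a = Dom C f" "Cod C b = Dom C s" "f \<cdot> a = s \<cdot> b"
  obtains u where "u \<in> Arr C" "Dom C u = Dom C a" "Cod C u = Dom C s'" "s' \<cdot> u = a" "f' \<cdot> u = b"
  using is_pullback_ex1[OF assms(1-7)] that unfolding Hom_def by blast

lemma is_pullback_unique:
  assumes "is_pullback C f s s' f'" "u \<in> Arr C" "v \<in> Arr C"
    "Dom C u = Dom C v" "Cod C u = Dom C s'" "Cod C v = Dom C s'"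
    "s' \<cdot> u = s' \<cdot> v" "f' \<cdot> u = f' \<cdot> v"
  shows "u = v"
proof -
  note pb = is_pullbackD[OF assms(1)]
  have "f \<cdot> (s' \<cdot> u) = s \<cdot> (f' \<cdot> u)"
    using assms pb Comp_assoc by metis
  then have "\<exists>!w. w \<in> Hom C (Dom C (s' \<cdot> u)) (Dom C s') \<and> s' \<cdot> w = s' \<cdot> u \<and> f' \<cdot> w = f' \<cdot> u"
    using assms(2-6) pb by (intro is_pullback_ex1[OF assms(1)]) simp_all
  moreover have "u \<in> Hom C (Dom C (s' \<cdot> u)) (Dom C s')" "v \<in> Hom C (Dom C (s' \<cdot> u)) (Dom C s')"
    using assms pb by (auto simp: Hom_def)
  ultimately show ?thesis using assms by metis
qed

lemma is_pullbackI:
  assumes "f \<in> Arr C" "s \<in> Arr C" "s' \<in> Arr C" "f' \<in> Arr C"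
    "Cod C f = Cod C s" "Dom C s' = Dom C f'" "Cod C s' = Dom C f" "Cod C f' = Dom C s"
    "f \<cdot> s' = s \<cdot> f'"
    and lift: "\<And>a b. \<lbrakk>a \<in> Arr C; b \<in> Arr C; Dom C a = Dom C b; Cod C a = Dom C f; Cod C b = Dom C s;
      f \<cdot> a = s \<cdot> b\<rbrakk> \<Longrightarrow> \<exists>u \<in> Arr C. Dom C u = Dom C a \<and> Cod C u = Dom C s' \<and> s' \<cdot> u = a \<and> f' \<cdot> u = b"
    and unique: "\<And>u v. \<lbrakk>u \<in> Arr C; v \<in> Arr C; Dom C u = Dom C v; Cod C u = Dom C s'; Cod C v = Dom C s';
      s' \<cdot> u = s' \<cdot> v; f' \<cdot> u = f' \<cdot> v\<rbrakk> \<Longrightarrow> u = v"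
  shows "is_pullback C f s s' f'"
  unfolding is_pullback_def
proof (intro conjI ballI impI)
  fix a b assume "a \<in> Arr C" "b \<in> Arr C"
    "Dom C a = Dom C b \<and> Cod C a = Dom C f \<and> Cod C b = Dom C s \<and> f \<cdot> a = s \<cdot> b"
  then obtain u where "u \<in> Hom C (Dom C a) (Dom C s')" "s' \<cdot> u = a" "f' \<cdot> u = b"
    using lift[of a b] unfolding Hom_def by auto
  then show "\<exists>!u. u \<in> Hom C (Dom C a) (Dom C s') \<and> s' \<cdot> u = a \<and> f' \<cdot> u = b"
    using unique unfolding Hom_def by (intro ex1I[of _ u]) auto
qed (use assms in auto)

lemma is_pullback_sym:
  assumes "is_pullback C f s s' f'"
  shows "is_pullback C s f f' s'"
proof -
  note pb = is_pullbackD[OF assms]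
  show ?thesis
  proof (rule is_pullbackI)
    fix a b assume "a \<in> Arr C" "b \<in> Arr C" "Dom C a = Dom C b" "Cod C a = Dom C s" "Cod C b = Dom C f"
      "s \<cdot> a = f \<cdot> b"
    then show "\<exists>u \<in> Arr C. Dom C u = Dom C a \<and> Cod C u = Dom C f' \<and> f' \<cdot> u = a \<and> s' \<cdot> u = b"
      using is_pullback_lift[OF assms, of b a] pb by (metis (no_types, lifting))
  next
    fix u v assume "u \<in> Arr C" "v \<in> Arr C" "Dom C u = Dom C v" "Cod C u = Dom C f'" "Cod C v = Dom C f'"
      "f' \<cdot> u = f' \<cdot> v" "s' \<cdot> u = s' \<cdot> v"
    then show "u = v"
      using is_pullback_unique[OF assms, of u v] pb by metis
  qed (use pb in auto)
qed

lemma is_pullback_paste: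
  assumes "is_pullback C f s s' f'" "is_pullback C k s' s'' k'"
  shows "is_pullback C (f \<cdot> k) s s'' (f' \<cdot> k')"
proof -
  note pb = is_pullbackD[OF assms(1)] is_pullbackD[OF assms(2)]
  have sq: "f \<cdot> (s' \<cdot> k') = s \<cdot> (f' \<cdot> k')"
    using pb Comp_reassoc[of f s' "s \<cdot> f'" k'] by simp
  show ?thesis
  proof (rule is_pullbackI)
    show "f \<cdot> k \<cdot> s'' = s \<cdot> (f' \<cdot> k')" using pb sq by simp
  next
    fix a b assume ab: "a \<in> Arr C" "b \<in> Arr C" "Dom C a = Dom C b" "Cod C a = Dom C (f \<cdot> k)"
      "Cod C b = Dom C s" "f \<cdot> k \<cdot> a = s \<cdot> b"
    then have "f \<cdot> (k \<cdot> a) = s \<cdot> b" using pb by simp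
    then obtain u where u: "u \<in> Arr C" "Dom C u = Dom C a" "Cod C u = Dom C s'"
        "s' \<cdot> u = k \<cdot> a" "f' \<cdot> u = b"
      using is_pullback_lift[OF assms(1), of "k \<cdot> a" b] ab pb by auto
    then obtain w where w: "w \<in> Arr C" "Dom C w = Dom C a" "Cod C w = Dom C s''"
        "s'' \<cdot> w = a" "k' \<cdot> w = u"
      using is_pullback_lift[OF assms(2), of a u] ab pb by auto
    then show "\<exists>u \<in> Arr C. Dom C u = Dom C a \<and> Cod C u = Dom C s'' \<and> s'' \<cdot> u = a \<and> f' \<cdot> k' \<cdot> u = b"
      using u pb by (intro bexI[of _ w]) auto
  next
    fix u v assume uv: "u \<in> Arr C" "v \<in> Arr C" "Dom C u = Dom C v" "Cod C u = Dom C s''"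
      "Cod C v = Dom C s''" "s'' \<cdot> u = s'' \<cdot> v" "f' \<cdot> k' \<cdot> u = f' \<cdot> k' \<cdot> v"
    have "s' \<cdot> (k' \<cdot> w) = k \<cdot> (s'' \<cdot> w)" if "w \<in> Arr C" "Cod C w = Dom C s''" for w
      using Comp_reassoc[OF pb(18)[symmetric], of w] that pb(1-17) by simp
    then have "s' \<cdot> (k' \<cdot> u) = s' \<cdot> (k' \<cdot> v)"
      using uv by simp
    then have "k' \<cdot> u = k' \<cdot> v"
      using is_pullback_unique[OF assms(1), of "k' \<cdot> u" "k' \<cdot> v"] uv pb by simp
    then show "u = v"
      using is_pullback_unique[OF assms(2), of u v] uv by simp
  qed (use pb in auto)
qed

text \<open>A cone on the inner square becomes a cone on the outer one after composing with
  \<open>f'\<close>. The resulting lift has the right second leg because both candidates agree under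
  \<open>s'\<close> and under \<open>f'\<close>. This is how comparison maps between composite spans
  are recognised as pullbacks.\<close>

lemma is_pullback_cancel:
  assumes "is_pullback C f s s' f'" "is_pullback C (f \<cdot> k) s s'' (f' \<cdot> k')"
    and k: "k \<in> Arr C" "Cod C k = Dom C f" and k': "k' \<in> Arr C" "Cod C k' = Dom C f'"
    and sq: "k \<cdot> s'' = s' \<cdot> k'"
  shows "is_pullback C k s' s'' k'"
proof -
  note pb = is_pullbackD[OF assms(1)]
  have pb2: "s'' \<in> Arr C" "Dom C s'' = Dom C k'" "Cod C s'' = Dom C k"
    using is_pullbackD[OF assms(2)] k k' pb by auto
  show ?thesis
  proof (rule is_pullbackI)
    fix a b assume ab: "a \<in> Arr C" "b \<in> Arr C" "Dom C a = Dom C b" "Cod C a = Dom C k"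
      "Cod C b = Dom C s'" "k \<cdot> a = s' \<cdot> b"
    then have "f \<cdot> k \<cdot> a = s \<cdot> (f' \<cdot> b)"
      using Comp_reassoc[of f s' "s \<cdot> f'" b] pb k by simp
    then obtain u where u: "u \<in> Arr C" "Dom C u = Dom C a" "Cod C u = Dom C s''"
        "s'' \<cdot> u = a" "f' \<cdot> k' \<cdot> u = f' \<cdot> b"
      using is_pullback_lift[OF assms(2), of a "f' \<cdot> b"] ab pb k by auto
    have "s' \<cdot> (k' \<cdot> u) = k \<cdot> (s'' \<cdot> u)"
      using Comp_reassoc[OF sq[symmetric], of u] u k k' pb pb2 by simp
    then have "k' \<cdot> u = b"
      using is_pullback_unique[OF assms(1), of "k' \<cdot> u" b] ab u k k' pb pb2 by simp
    then show "\<exists>u \<in> Arr C. Dom C u = Dom C a \<and> Cod C u = Dom C s'' \<and> s'' \<cdot> u = a \<and> k' \<cdot> u = b"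
      using u by blast
  next
    fix u v assume uv: "u \<in> Arr C" "v \<in> Arr C" "Dom C u = Dom C v" "Cod C u = Dom C s''"
      "Cod C v = Dom C s''" "s'' \<cdot> u = s'' \<cdot> v" "k' \<cdot> u = k' \<cdot> v"
    then show "u = v"
      using is_pullback_unique[OF assms(2), of u v] k' pb pb2 by simp
  qed (use k k' pb pb2 sq in auto)
qed

lemma is_pullback_Ide:
  assumes "f \<in> Arr C"
  shows "is_pullback C f (Ide C (Cod C f)) (Ide C (Dom C f)) f"
  by (rule is_pullbackI) (use assms in auto)

lemma is_pullback_iso:
  assumes "is_iso C x"
  shows "is_pullback C (Ide C (Cod C x)) (Ide C (Cod C x)) x x"
proof -
  obtain g where g: "x \<in> Arr C" "g \<in> Arr C" "Dom C g = Cod C x" "Cod C g = Dom C x"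
    "g \<cdot> x = Ide C (Dom C x)" "x \<cdot> g = Ide C (Cod C x)"
    using assms by (rule is_isoE)
  show ?thesis
  proof (rule is_pullbackI)
    fix a b assume "a \<in> Arr C" "b \<in> Arr C" "Cod C a = Dom C (Ide C (Cod C x))"
      "Cod C b = Dom C (Ide C (Cod C x))" "Ide C (Cod C x) \<cdot> a = Ide C (Cod C x) \<cdot> b"
    then show "\<exists>u \<in> Arr C. Dom C u = Dom C a \<and> Cod C u = Dom C x \<and> x \<cdot> u = a \<and> x \<cdot> u = b"
      using g Comp_reassoc[OF g(6)] by (intro bexI[of _ "g \<cdot> a"]) auto
  next
    fix u v assume uv: "u \<in> Arr C" "v \<in> Arr C" "Cod C u = Dom C x" "Cod C v = Dom C x"
      "x \<cdot> u = x \<cdot> v"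
    have "g \<cdot> (x \<cdot> w) = w" if "w \<in> Arr C" "Cod C w = Dom C x" for w
      using Comp_reassoc[OF g(5), of w] g that by simp
    from this[OF uv(1,3)] this[OF uv(2,4)] show "u = v" unfolding uv(5) by simp
  qed (use g in auto)
qed

text \<open>With \<open>g\<close> inverse to \<open>w\<close>, the cone formed by the identity and
  \<open>g \<cdot> h\<close> lifts to a right inverse of \<open>x\<close>; that it is also a left
  inverse follows from uniqueness of lifts.\<close>

lemma is_pullback_of_iso:
  assumes "is_pullback C h w x y" "is_iso C w"
  shows "is_iso C x"
proof -
  note pb = is_pullbackD[OF assms(1)]
  obtain g where g: "w \<in> Arr C" "g \<in> Arr C" "Dom C g = Cod C w" "Cod C g = Dom C w"
    "g \<cdot> w = Ide C (Dom C w)" "w \<cdot> g = Ide C (Cod C w)"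
    using assms(2) by (rule is_isoE)
  have "h \<cdot> Ide C (Dom C h) = w \<cdot> (g \<cdot> h)"
    using g pb Comp_reassoc[OF g(6), of h] by simp
  then obtain u where u: "u \<in> Arr C" "Dom C u = Dom C h" "Cod C u = Dom C x"
      "x \<cdot> u = Ide C (Dom C h)" "y \<cdot> u = g \<cdot> h"
    using is_pullback_lift[OF assms(1), of "Ide C (Dom C h)" "g \<cdot> h"] g pb by auto
  have "y \<cdot> (u \<cdot> x) = g \<cdot> (w \<cdot> y)"
    using Comp_reassoc[OF u(5), of x] u g pb by simp
  also have "\<dots> = y"
    using Comp_reassoc[OF g(5), of y] g pb by simp
  finally have "u \<cdot> x = Ide C (Dom C x)"
    using is_pullback_unique[OF assms(1), of "u \<cdot> x" "Ide C (Dom C x)"]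
      Comp_reassoc[OF u(4), of x] u pb by simp
  then show ?thesis using u pb by (intro is_isoI[of x u]) auto
qed

lemma is_pullback_iso_unique:
  assumes "is_pullback C f s s' f'" "is_pullback C f s t g"
  obtains u where "is_iso C u" "Dom C u = Dom C t" "Cod C u = Dom C s'" "s' \<cdot> u = t" "f' \<cdot> u = g"
proof -
  note pb = is_pullbackD[OF assms(1)] is_pullbackD[OF assms(2)]
  obtain u where u: "u \<in> Arr C" "Dom C u = Dom C t" "Cod C u = Dom C s'" "s' \<cdot> u = t" "f' \<cdot> u = g"
    using is_pullback_lift[OF assms(1), of t g] pb by auto
  obtain v where v: "v \<in> Arr C" "Dom C v = Dom C s'" "Cod C v = Dom C t" "t \<cdot> v = s'" "g \<cdot> v = f'"
    using is_pullback_lift[OF assms(2), of s' f'] pb by auto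
  have "u \<cdot> v = Ide C (Dom C s')"
    using is_pullback_unique[OF assms(1), of "u \<cdot> v" "Ide C (Dom C s')"]
      Comp_reassoc[OF u(4), of v] Comp_reassoc[OF u(5), of v] u v pb by simp
  moreover have "v \<cdot> u = Ide C (Dom C t)"
    using is_pullback_unique[OF assms(2), of "v \<cdot> u" "Ide C (Dom C t)"]
      Comp_reassoc[OF v(4), of u] Comp_reassoc[OF v(5), of u] u v pb by simp
  ultimately have "is_iso C u" using u v by (intro is_isoI[of u v]) auto
  then show thesis using that u by blast
qed

end

section \<open>The category of partial maps\<close>

text \<open>A relation instead of a function, since pullbacks are given only up to isomorphism;
  every choice of pullback counts as a composite.\<close>

definition span_comp ::
    "('o, 'm, 'x) cat_scheme \<Rightarrow> 'm \<times> 'm \<Rightarrow> 'm \<times> 'm \<Rightarrow> 'm \<times> 'm \<Rightarrow> bool" where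
  "span_comp C p q r \<longleftrightarrow> (\<exists>t' f'. is_pullback C (snd p) (fst q) t' f' \<and>
     r = (fst p \<cdot>\<^bsub>C\<^esub> t', snd q \<cdot>\<^bsub>C\<^esub> f'))"

definition par_map ::
    "('o, 'm, 'x) cat_scheme \<Rightarrow> 'm set \<Rightarrow> 'm \<Rightarrow> 'm \<Rightarrow> 'o \<times> 'o \<times> ('m \<times> 'm) set" where
  "par_map C S s f = (Cod C s, Cod C f, span_class C S (s, f))"

context stably_structured
begin

lemma S_Arr [simp]: "s \<in> S \<Longrightarrow> s \<in> Arr C"
  using S_subset by blast

lemma Ide_in_S [simp]: "A \<in> Obj C \<Longrightarrow> Ide C A \<in> S"
  by (intro iso_in_S is_iso_Ide)

section \<open>Members of \<open>S_star\<close> and their stability\<close>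

lemma S_starI:
  assumes "c \<in> cospans C S A B" "d \<in> cospans C S A B" "cospan_mor C v c d" "v \<in> S"
    "is_conjugate C c d w" "is_pullback C h w x y"
  shows "x \<in> S_star C S"
  using assms unfolding S_star_def by blast

text \<open>The identity is a conjugate of the identity cospan morphism, and an isomorphism is a
  pullback of an identity. Hence both kinds of generating step can be treated alike.\<close>

lemma iso_in_S_star:
  assumes "is_iso C x"
  shows "x \<in> S_star C S"
proof -
  let ?i = "Ide C (Cod C x)"
  have x: "Cod C x \<in> Obj C" using assms by (auto simp: is_iso_def)
  have pb: "is_pullback C ?i ?i ?i ?i"
    using is_pullback_Ide[of ?i] x by simp
  show ?thesis
  proof (rule S_starI)
    show "is_conjugate C (?i, ?i) (?i, ?i) ?i"
      unfolding is_conjugate_def case_prod_conv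
      by (intro exI[of _ ?i] conjI pb) (auto simp: x Hom_def)
    show "is_pullback C ?i ?i x x" using assms by (rule is_pullback_iso)
    show "cospan_mor C ?i (?i, ?i) (?i, ?i)"
      using x by (simp add: cospan_mor_def Hom_def)
  qed (auto simp: x cospans_def cospan_mor_def Hom_def)
qed

text \<open>By definition \<open>x\<close> is already a pullback of a conjugate, so pasting the two
  squares exhibits \<open>x'\<close> as a pullback of the same conjugate.\<close>

lemma S_star_pullback:
  assumes "x \<in> S_star C S" "is_pullback C k x x' k'"
  shows "x' \<in> S_star C S"
proof -
  obtain A B c d v w h y where *: "c \<in> cospans C S A B" "d \<in> cospans C S A B" "cospan_mor C v c d"
    "v \<in> S" "is_conjugate C c d w" and "is_pullback C h w x y"
    using assms(1) unfolding S_star_def by blast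
  from is_pullback_paste[OF this(6) assms(2)] show ?thesis by (rule S_starI[OF *])
qed

lemma diagonal_in_S_star:
  assumes "s \<in> S" "is_pullback C s s p q" "d \<in> Hom C (Dom C s) (Dom C p)"
    "p \<cdot> d = Ide C (Dom C s)" "q \<cdot> d = Ide C (Dom C s)"
  shows "d \<in> S_star C S"
proof -
  let ?i = "Ide C (Dom C s)"
  have s: "s \<in> Arr C" "Dom C s \<in> Obj C" using assms(1) by auto
  have pb: "is_pullback C ?i ?i ?i ?i"
    using is_pullback_Ide[of ?i] s by simp
  show ?thesis
  proof (rule S_starI)
    show "is_conjugate C (?i, ?i) (s, s) d"
      unfolding is_conjugate_def case_prod_conv
      by (intro exI conjI, rule pb, rule assms(2)) (use assms s in \<open>auto simp: Hom_def\<close>)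
    \<comment> \<open>The conjugate itself belongs to \<open>S_star\<close> as its own pullback
      along an identity.\<close>
    show "is_pullback C (Ide C (Cod C d)) d d (Ide C (Dom C d))"
      using assms(3) by (intro is_pullback_sym[OF is_pullback_Ide]) (auto simp: Hom_def)
  qed (use assms s in \<open>auto simp: cospans_def cospan_mor_def Hom_def\<close>)
qed

section \<open>Steps between spans and their compatibility with composition\<close>

lemma in_spans [simp]:
  "(s, f) \<in> spans C S A B \<longleftrightarrow> s \<in> S \<and> f \<in> Arr C \<and> Dom C s = Dom C f \<and> Cod C s = A \<and> Cod C f = B"
  by (auto simp: spans_def)

lemma span_step_iff:
  "span_step C S p q \<longleftrightarrow> (\<exists>A B x. p \<in> spans C S A B \<and> q \<in> spans C S A B \<and>
     span_mor C x p q \<and> x \<in> S_star C S)"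
  unfolding span_step_def using iso_in_S_star by blast

lemma span_step_spans:
  "span_step C S p q \<Longrightarrow> p \<in> spans C S A B \<longleftrightarrow> q \<in> spans C S A B"
  by (cases p; cases q) (auto simp: span_step_def)

lemma span_stepE:
  assumes "span_step C S (s, f) (s1, f1)"
  obtains x where "x \<in> S_star C S" "x \<in> Arr C" "Dom C x = Dom C s" "Cod C x = Dom C s1"
    "s1 \<cdot> x = s" "f1 \<cdot> x = f"
proof -
  obtain x where "span_mor C x (s, f) (s1, f1)" "x \<in> S_star C S"
    using assms unfolding span_step_iff by blast
  then show thesis
    using that unfolding span_mor_def Hom_def by blast
qed

text \<open>Reflexive steps make the compatibility lemmas below cover two composites of the same
  spans that differ only in the chosen pullbacks.\<close>

lemma span_step_refl:
  assumes "p \<in> spans C S A B"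
  shows "span_step C S p p"
proof -
  obtain s f where p: "p = (s, f)" "s \<in> S" "f \<in> Arr C" "Dom C s = Dom C f"
    using assms by (cases p) auto
  then have "span_mor C (Ide C (Dom C s)) p p" "is_iso C (Ide C (Dom C s))"
    by (auto simp: span_mor_def Hom_def is_iso_Ide)
  then show ?thesis using assms unfolding span_step_def by blast
qed

lemma span_comp_ex:
  assumes "p \<in> spans C S A B" "q \<in> spans C S B D"
  obtains r where "span_comp C p q r"
  using assms pullback_exists[of "fst q" "snd p"] that
  by (cases p; cases q) (auto simp: span_comp_def)

lemma span_comp_in_spans:
  assumes "span_comp C p q r" "p \<in> spans C S A B" "q \<in> spans C S B D"
  shows "r \<in> spans C S A D"
proof -
  obtain t' f' where pb: "is_pullback C (snd p) (fst q) t' f'"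
    and r: "r = (fst p \<cdot> t', snd q \<cdot> f')"
    using assms(1) by (auto simp: span_comp_def)
  have "t' \<in> S" using pullback_in_S[OF _ pb] assms(3) by (cases q) auto
  then show ?thesis
    using assms(2,3) is_pullbackD[OF pb] r Comp_in_S by (cases p; cases q) auto
qed

text \<open>The morphism \<open>x\<close> induces a map \<open>x'\<close> between the apexes of the
  two pullbacks. Cancelling the square of \<open>f1\<close> and \<open>t\<close> from that of
  \<open>f1 \<cdot> x\<close> and \<open>t\<close> shows that \<open>x'\<close> is the pullback of
  \<open>x\<close> along \<open>t1\<close>, so it remains in \<open>S_star\<close>.\<close>

lemma span_step_comp_left:
  assumes step: "span_step C S p p1" and p: "p \<in> spans C S A B" and q: "q \<in> spans C S B D"
    and r: "span_comp C p q r" and r1: "span_comp C p1 q r1"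
  shows "span_step C S r r1"
proof -
  obtain s f s1 f1 t g where [simp]: "p = (s, f)" "p1 = (s1, f1)" "q = (t, g)"
    by (cases p; cases p1; cases q)
  obtain x where x: "x \<in> S_star C S" "x \<in> Arr C" "Dom C x = Dom C s" "Cod C x = Dom C s1"
      "s1 \<cdot> x = s" "f1 \<cdot> x = f"
    using step by (auto elim: span_stepE)
  have p1: "p1 \<in> spans C S A B" using span_step_spans[OF step] p by blast
  obtain t' f' where pb: "is_pullback C f t t' f'" and [simp]: "r = (s \<cdot> t', g \<cdot> f')"
    using r by (auto simp: span_comp_def)
  obtain t1 g1 where pb1: "is_pullback C f1 t t1 g1" and [simp]: "r1 = (s1 \<cdot> t1, g \<cdot> g1)"
    using r1 by (auto simp: span_comp_def)
  note D = is_pullbackD[OF pb] is_pullbackD[OF pb1]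
  have "f1 \<cdot> (x \<cdot> t') = t \<cdot> f'"
    using Comp_reassoc[OF x(6), of t'] D x p p1 by simp
  then obtain x' where x': "x' \<in> Arr C" "Dom C x' = Dom C t'" "Cod C x' = Dom C t1"
      "t1 \<cdot> x' = x \<cdot> t'" "g1 \<cdot> x' = f'"
    using is_pullback_lift[OF pb1, of "x \<cdot> t'" f'] D x p p1 by auto
  have "is_pullback C x t1 t' x'"
    using is_pullback_cancel[OF pb1, of x t' x'] pb D x x' p p1 by simp
  then have "x' \<in> S_star C S"
    using S_star_pullback[OF x(1)] is_pullback_sym by blast
  moreover have "span_mor C x' r r1"
    using Comp_reassoc[OF x(5), of t'] D x x' p p1 q by (simp add: span_mor_def Hom_def)
  ultimately show ?thesis
    using span_comp_in_spans[OF r p q] span_comp_in_spans[OF r1 p1 q]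
    unfolding span_step_iff by blast
qed

text \<open>The mirror image of \<open>span_step_comp_left\<close>: the induced map
  \<open>y'\<close> is the pullback of \<open>y\<close> along \<open>f1'\<close>.\<close>

lemma span_step_comp_right:
  assumes step: "span_step C S q q1" and p: "p \<in> spans C S A B" and q: "q \<in> spans C S B D"
    and r: "span_comp C p q r" and r1: "span_comp C p q1 r1"
  shows "span_step C S r r1"
proof -
  obtain s f t1 g1 t g where [simp]: "p = (s, f)" "q1 = (t1, g1)" "q = (t, g)"
    by (cases p; cases q1; cases q)
  obtain y where y: "y \<in> S_star C S" "y \<in> Arr C" "Dom C y = Dom C t" "Cod C y = Dom C t1"
      "t1 \<cdot> y = t" "g1 \<cdot> y = g"
    using step by (auto elim: span_stepE)
  have q1: "q1 \<in> spans C S B D" using span_step_spans[OF step] q by blast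
  obtain t' f' where pb: "is_pullback C f t t' f'" and [simp]: "r = (s \<cdot> t', g \<cdot> f')"
    using r by (auto simp: span_comp_def)
  obtain t1' f1' where pb1: "is_pullback C f t1 t1' f1'" and [simp]: "r1 = (s \<cdot> t1', g1 \<cdot> f1')"
    using r1 by (auto simp: span_comp_def)
  note D = is_pullbackD[OF pb] is_pullbackD[OF pb1]
  have "f \<cdot> t' = t1 \<cdot> (y \<cdot> f')"
    using Comp_reassoc[OF y(5), of f'] D y q q1 by simp
  then obtain y' where y': "y' \<in> Arr C" "Dom C y' = Dom C t'" "Cod C y' = Dom C t1'"
      "t1' \<cdot> y' = t'" "f1' \<cdot> y' = y \<cdot> f'"
    using is_pullback_lift[OF pb1, of t' "y \<cdot> f'"] D y q q1 by auto
  have "is_pullback C y f1' f' y'"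
    using is_pullback_cancel[OF is_pullback_sym[OF pb1], of y f' y'] is_pullback_sym[OF pb] D y y' q q1
    by simp
  then have "y' \<in> S_star C S"
    using S_star_pullback[OF y(1)] is_pullback_sym by blast
  moreover have "span_mor C y' r r1"
    using Comp_reassoc[OF y(6), of f'] D y y' p q q1 by (simp add: span_mor_def Hom_def)
  ultimately show ?thesis
    using span_comp_in_spans[OF r p q] span_comp_in_spans[OF r1 p q1]
    unfolding span_step_iff by blast
qed

lemma span_equiv_spans:
  "equivclp (span_step C S) p q \<Longrightarrow> p \<in> spans C S A B \<Longrightarrow> q \<in> spans C S A B"
  by (induction rule: equivclp_induct) (use span_step_spans in blast)+

text \<open>One factor is varied at a time, by induction along the chain of steps.\<close>

lemma span_equiv_comp:
  assumes "equivclp (span_step C S) p p1" "equivclp (span_step C S) q q1"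
    and p: "p \<in> spans C S A B" and q: "q \<in> spans C S B D"
    and r: "span_comp C p q r" and r1: "span_comp C p1 q1 r1"
  shows "equivclp (span_step C S) r r1"
proof -
  have left: "equivclp (span_step C S) r r'" if "span_comp C p1 q r'" for r'
    using assms(1) that
  proof (induction arbitrary: r' rule: equivclp_induct)
    case base
    then show ?case
      using span_step_comp_left[OF span_step_refl[OF p] p q r] by blast
  next
    case (step y z)
    have yz: "y \<in> spans C S A B" "z \<in> spans C S A B"
      using step.hyps p span_equiv_spans span_step_spans by blast+
    \<comment> \<open>The induction hypothesis speaks of composites of the intermediate span
      \<open>y\<close>, so one has to be produced; its relation to \<open>r'\<close> points in the
      direction of the step.\<close>
    obtain w where w: "span_comp C y q w" using span_comp_ex[OF yz(1) q] .
    then have "span_step C S w r' \<or> span_step C S r' w"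
      using step.hyps(2) step.prems span_step_comp_left yz q by blast
    then show ?case using step.IH[OF w] by (meson equivclp_into_equivclp)
  qed
  have p1: "p1 \<in> spans C S A B" using assms(1) p span_equiv_spans by blast
  show ?thesis
    using assms(2) r1
  proof (induction arbitrary: r1 rule: equivclp_induct)
    case base
    then show ?case using left by blast
  next
    case (step y z)
    have yz: "y \<in> spans C S B D" "z \<in> spans C S B D"
      using step.hyps q span_equiv_spans span_step_spans by blast+
    obtain w where w: "span_comp C p1 y w" using span_comp_ex[OF p1 yz(1)] .
    then have "span_step C S w r1 \<or> span_step C S r1 w"
      using step.hyps(2) step.prems span_step_comp_right yz p1 by blast
    then show ?case using step.IH[OF w] by (meson equivclp_into_equivclp)
  qed
qed

lemma span_equiv_rst:
  "equivclp (span_step C S) p q \<Longrightarrow> equivclp (span_step C S) (fst p, fst p) (fst q, fst q)"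
proof (induction rule: equivclp_induct)
  case (step y z)
  \<comment> \<open>The same underlying morphism works, since only its condition on the left legs is
    involved.\<close>
  have "span_step C S (fst a, fst a) (fst b, fst b)" if "span_step C S a b" for a b
    using that unfolding span_step_iff span_mor_def by fastforce
  then show ?case using step by (meson equivclp_into_equivclp)
qed simp

lemma span_class_eq_iff: "span_class C S p = span_class C S q \<longleftrightarrow> equivclp (span_step C S) p q"
  unfolding span_class_def by (auto intro: equivclp_sym equivclp_trans)

section \<open>Calculus of arrows of \<open>Par C S\<close>\<close>

lemma Par_simps [simp]:
  "Obj (Par C S) = Obj C"
  "A \<in> Obj C \<Longrightarrow> Ide (Par C S) A = par_map C S (Ide C A) (Ide C A)"
  "Dom (Par C S) (par_map C S s f) = Cod C s"
  "Cod (Par C S) (par_map C S s f) = Cod C f"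
  by (simp_all add: Par_def par_map_def)

lemma Par_Arr [simp, intro]:
  "s \<in> S \<Longrightarrow> f \<in> Arr C \<Longrightarrow> Dom C s = Dom C f \<Longrightarrow> par_map C S s f \<in> Arr (Par C S)"
  by (auto simp: Par_def par_map_def)

lemma Par_ArrE:
  assumes "a \<in> Arr (Par C S)"
  obtains s f where "s \<in> S" "f \<in> Arr C" "Dom C s = Dom C f" "a = par_map C S s f"
  using assms by (auto simp: Par_def par_map_def)

lemma par_map_eqI: "span_step C S (s, f) (t, g) \<Longrightarrow> par_map C S s f = par_map C S t g"
  unfolding par_map_def
  using span_class_eq_iff[of "(s, f)" "(t, g)"] r_into_equivclp[of "span_step C S"]
  by (auto simp: span_step_def)

text \<open>By the congruence property all the classes united in the definition of composition
  coincide, so any single pullback square of any representatives computes the composite.\<close>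

lemma par_map_Comp:
  assumes s: "s \<in> S" "f \<in> Arr C" "Dom C s = Dom C f" and t: "t \<in> S" "g \<in> Arr C" "Dom C t = Dom C g"
    and pb: "is_pullback C f t t' f'"
  shows "par_map C S t g \<cdot>\<^bsub>Par C S\<^esub> par_map C S s f = par_map C S (s \<cdot> t') (g \<cdot> f')"
proof -
  note D = is_pullbackD[OF pb]
  let ?X = "span_class C S (s, f)" and ?Y = "span_class C S (t, g)"
  have sp: "(s, f) \<in> spans C S (Cod C s) (Cod C f)" "(t, g) \<in> spans C S (Cod C f) (Cod C g)"
    using s t D by auto
  have r: "span_comp C (s, f) (t, g) (s \<cdot> t', g \<cdot> f')"
    using pb by (auto simp: span_comp_def)
  have "span_class C S (s0 \<cdot> t0', g0 \<cdot> f0') = span_class C S (s \<cdot> t', g \<cdot> f')"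
    if "(s0, f0) \<in> ?X" "(t0, g0) \<in> ?Y" "is_pullback C f0 t0 t0' f0'" for s0 f0 t0 g0 t0' f0'
  proof -
    have "span_comp C (s0, f0) (t0, g0) (s0 \<cdot> t0', g0 \<cdot> f0')"
      using that by (auto simp: span_comp_def)
    from span_equiv_comp[OF _ _ sp r this] that(1,2)
    have "equivclp (span_step C S) (s \<cdot> t', g \<cdot> f') (s0 \<cdot> t0', g0 \<cdot> f0')"
      unfolding span_class_def by blast
    then show ?thesis using span_class_eq_iff by metis
  qed
  moreover have "(s, f) \<in> ?X" "(t, g) \<in> ?Y" by (auto simp: span_class_def)
  ultimately have "{span_class C S (s \<cdot> t', g \<cdot> f') | s f t g t' f'.
      (s, f) \<in> ?X \<and> (t, g) \<in> ?Y \<and> is_pullback C f t t' f'} = {span_class C S (s \<cdot> t', g \<cdot> f')}"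
    using pb by blast
  then show ?thesis
    using D s t by (simp add: Par_def par_map_def)
qed

lemma par_map_Rst:
  "Rst (Par C S) (par_map C S s f) = par_map C S s s"
proof -
  have "span_class C S (s0, s0) = span_class C S (s, s)" if "(s0, f0) \<in> span_class C S (s, f)" for s0 f0
  proof -
    have "equivclp (span_step C S) (s, f) (s0, f0)" using that unfolding span_class_def by blast
    from span_equiv_rst[OF this] show ?thesis using span_class_eq_iff by (metis fst_conv)
  qed
  moreover have "(s, f) \<in> span_class C S (s, f)" by (auto simp: span_class_def)
  ultimately have "{span_class C S (s', s') | s' f'. (s', f') \<in> span_class C S (s, f)} = {span_class C S (s, s)}"
    by blast
  then show ?thesis by (simp add: Par_def par_map_def)
qed

text \<open>One of the two legs to be pulled back is an identity here, as it is in the next lemma.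
  Together they reduce the factorisation of \<open>[s, f]\<close> through \<open>F\<close> and
  \<open>R\<close> to rewriting.\<close>

lemma par_map_comp_total:
  assumes "s \<in> S" "f \<in> Arr C" "Dom C s = Dom C f" "g \<in> Arr C" "Cod C f = Dom C g"
  shows "par_map C S (Ide C (Dom C g)) g \<cdot>\<^bsub>Par C S\<^esub> par_map C S s f = par_map C S s (g \<cdot> f)"
  using par_map_Comp[of s f "Ide C (Dom C g)" g "Ide C (Dom C f)" f] is_pullback_Ide[of f] assms by simp

lemma par_map_comp_inverse:
  assumes "t \<in> S" "f \<in> Arr C" "Dom C t = Dom C f" "s \<in> S" "Cod C t = Dom C s"
  shows "par_map C S t f \<cdot>\<^bsub>Par C S\<^esub> par_map C S s (Ide C (Dom C s)) = par_map C S (s \<cdot> t) f"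
  using par_map_Comp[of s "Ide C (Dom C s)" t f t "Ide C (Dom C t)"]
    is_pullback_sym[OF is_pullback_Ide[of t]] assms by simp

lemma category_Par: "category (Par C S)"
proof
  let ?P = "Par C S"
  show "Dom ?P f \<in> Obj ?P" "Cod ?P f \<in> Obj ?P" if a: "f \<in> Arr ?P" for f
    using that by (auto elim!: Par_ArrE)
  show "Ide ?P A \<in> Hom ?P A A" if "A \<in> Obj ?P" for A
    using that by (auto simp: Hom_def)
  show "g \<cdot>\<^bsub>?P\<^esub> f \<in> Hom ?P (Dom ?P f) (Cod ?P g)"
    if a: "f \<in> Arr ?P" "g \<in> Arr ?P" "Cod ?P f = Dom ?P g" for f g
  proof -
    obtain s u where f: "s \<in> S" "u \<in> Arr C" "Dom C s = Dom C u" "f = par_map C S s u"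
      using a(1) by (rule Par_ArrE)
    obtain t v where g: "t \<in> S" "v \<in> Arr C" "Dom C t = Dom C v" "g = par_map C S t v"
      using a(2) by (rule Par_ArrE)
    obtain t' u' where pb: "is_pullback C u t t' u'"
      using pullback_exists[of t u] f g a(3) by auto
    have "t' \<in> S" using pullback_in_S[OF g(1) pb] .
    then show ?thesis
      using par_map_Comp[OF f(1-3) g(1-3) pb] f g is_pullbackD[OF pb] Comp_in_S
      by (auto simp: Hom_def)
  qed
  show "f \<cdot>\<^bsub>?P\<^esub> Ide ?P (Dom ?P f) = f" if a: "f \<in> Arr ?P" for f
  proof -
    obtain s u where f: "s \<in> S" "u \<in> Arr C" "Dom C s = Dom C u" "f = par_map C S s u"
      using a by (rule Par_ArrE)
    then show ?thesis
      using par_map_comp_inverse[of s u "Ide C (Cod C s)"] by simp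
  qed
  show "Ide ?P (Cod ?P f) \<cdot>\<^bsub>?P\<^esub> f = f" if a: "f \<in> Arr ?P" for f
  proof -
    obtain s u where f: "s \<in> S" "u \<in> Arr C" "Dom C s = Dom C u" "f = par_map C S s u"
      using a by (rule Par_ArrE)
    then show ?thesis
      using par_map_comp_total[of s u "Ide C (Cod C u)"] by simp
  qed
  show "h \<cdot>\<^bsub>?P\<^esub> g \<cdot>\<^bsub>?P\<^esub> f = h \<cdot>\<^bsub>?P\<^esub> (g \<cdot>\<^bsub>?P\<^esub> f)"
    if a: "f \<in> Arr ?P" "g \<in> Arr ?P" "h \<in> Arr ?P" "Cod ?P f = Dom ?P g" "Cod ?P g = Dom ?P h" for f g h
  proof -
    obtain s u where f: "s \<in> S" "u \<in> Arr C" "Dom C s = Dom C u" "f = par_map C S s u"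
      using a(1) by (rule Par_ArrE)
    obtain t v where g: "t \<in> S" "v \<in> Arr C" "Dom C t = Dom C v" "g = par_map C S t v"
      using a(2) by (rule Par_ArrE)
    obtain r w where h: "r \<in> S" "w \<in> Arr C" "Dom C r = Dom C w" "h = par_map C S r w"
      using a(3) by (rule Par_ArrE)
    obtain t' u' where p: "is_pullback C u t t' u'"
      using pullback_exists[of t u] f g a(4) by auto
    obtain r' v' where q: "is_pullback C v r r' v'"
      using pullback_exists[of r v] g h a(5) by auto
    have S: "t' \<in> S" "r' \<in> S" using pullback_in_S g h p q by auto
    \<comment> \<open>This square completes both bracketings: pasted with \<open>q\<close> it
      computes \<open>h\<close> after the composite of \<open>g\<close> and \<open>f\<close>, and
      pasted with \<open>p\<close> it computes the composite of \<open>h\<close> and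
      \<open>g\<close> after \<open>f\<close>.\<close>
    obtain r'' u'' where m: "is_pullback C u' r' r'' u''"
      using pullback_exists[of r' u'] S is_pullbackD[OF p] is_pullbackD[OF q] g by auto
    note D = is_pullbackD[OF p] is_pullbackD[OF q] is_pullbackD[OF m]
    have "h \<cdot>\<^bsub>?P\<^esub> (g \<cdot>\<^bsub>?P\<^esub> f) = par_map C S (s \<cdot> t' \<cdot> r'') (w \<cdot> (v' \<cdot> u''))"
      using par_map_Comp[OF f(1-3) g(1-3) p]
        par_map_Comp[of "s \<cdot> t'" "v \<cdot> u'" r w, OF _ _ _ h(1-3) is_pullback_paste[OF q m]]
        f g h S D Comp_in_S by simp
    moreover have "is_pullback C u (t \<cdot> r') (t' \<cdot> r'') u''"
      using is_pullback_sym[OF is_pullback_paste[OF is_pullback_sym[OF p] is_pullback_sym[OF m]]] .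
    then have "h \<cdot>\<^bsub>?P\<^esub> g \<cdot>\<^bsub>?P\<^esub> f = par_map C S (s \<cdot> (t' \<cdot> r'')) (w \<cdot> v' \<cdot> u'')"
      using par_map_Comp[OF g(1-3) h(1-3) q]
        par_map_Comp[of s u "t \<cdot> r'" "w \<cdot> v'" "t' \<cdot> r''" u''] f g h S D Comp_in_S by simp
    ultimately show ?thesis using f g h D by simp
  qed
qed

lemma par_map_split:
  assumes "s \<in> S"
  shows "par_map C S s (Ide C (Dom C s)) \<cdot>\<^bsub>Par C S\<^esub> par_map C S (Ide C (Dom C s)) s
    = par_map C S (Ide C (Dom C s)) (Ide C (Dom C s))"
proof -
  let ?i = "Ide C (Dom C s)"
  have s: "s \<in> Arr C" "Dom C s \<in> Obj C" using assms by auto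
  obtain p q where pb: "is_pullback C s s p q"
    using pullback_exists[of s s] assms by auto
  note D = is_pullbackD[OF pb]
  obtain d where d: "d \<in> Arr C" "Dom C d = Dom C s" "Cod C d = Dom C p" "p \<cdot> d = ?i" "q \<cdot> d = ?i"
    using is_pullback_lift[OF pb, of ?i ?i] s by auto
  have "d \<in> S_star C S"
    using diagonal_in_S_star[OF assms pb, of d] d by (simp add: Hom_def)
  moreover have "p \<in> S" using pullback_in_S[OF assms pb] .
  \<comment> \<open>The kernel pair \<open>(p, q)\<close> represents the composite in question, and
    the diagonal \<open>d\<close> is a span morphism into it from the identity span.\<close>
  ultimately have "span_step C S (?i, ?i) (p, q)"
    unfolding span_step_iff using d s D
    by (intro exI[of _ "Dom C s"] exI[of _ d]) (simp add: span_mor_def Hom_def)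
  then have "par_map C S p q = par_map C S ?i ?i"
    by (rule par_map_eqI[symmetric])
  then show ?thesis
    using par_map_Comp[of ?i s s ?i p q] assms s pb D by simp
qed

end

section \<open>Split restriction categories, with partial maps as an instance\<close>

locale split_restriction_category = restriction_category X
  for X :: "('o, 'm, 'x) rcat_scheme" (structure) +
  assumes split: "e \<in> Arr X \<Longrightarrow> Rst X e = e \<Longrightarrow>
    \<exists>m r. m \<in> Hom X (Cod X r) (Dom X r) \<and> r \<in> Arr X \<and> m \<cdot> r = e \<and> r \<cdot> m = Ide X (Dom X m)"

context stably_structured
begin

theorem split_restriction_category_Par: "split_restriction_category (Par C S)"
proof -
  let ?P = "Par C S"
  let ?R = "\<lambda>s. par_map C S s (Ide C (Dom C s))" and ?F = "\<lambda>f. par_map C S (Ide C (Dom C f)) f"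
  interpret P: category ?P by (rule category_Par)
  have FR: "?F f \<cdot>\<^bsub>?P\<^esub> ?R s = par_map C S s f" if "s \<in> S" "f \<in> Arr C" "Dom C s = Dom C f" for s f
    using par_map_comp_total[of s "Ide C (Dom C s)" f] that by simp
  have FF: "?F g \<cdot>\<^bsub>?P\<^esub> ?F f = ?F (g \<cdot> f)" if "f \<in> Arr C" "g \<in> Arr C" "Cod C f = Dom C g" for f g
    using par_map_comp_total[of "Ide C (Dom C f)" f g] that by simp
  have RF: "?R s \<cdot>\<^bsub>?P\<^esub> (?F s \<cdot>\<^bsub>?P\<^esub> h) = h" if "s \<in> S" "h \<in> Arr ?P" "Cod ?P h = Dom C s" for s h
  proof -
    have "?R s \<cdot>\<^bsub>?P\<^esub> (?F s \<cdot>\<^bsub>?P\<^esub> h) = Ide ?P (Dom C s) \<cdot>\<^bsub>?P\<^esub> h"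
      by (subst P.Comp_reassoc[OF par_map_split]) (use that in simp_all)
    then show ?thesis using P.Ide_Comp[of h "Dom C s"] that by simp
  qed
  \<comment> \<open>After both arrows are expanded into \<open>F\<close> and \<open>R\<close>, the
    inner \<open>R s\<close> cancels against \<open>F s\<close>. \<open>R1\<close> is the case where
    \<open>t\<close> is an identity, and \<open>R4\<close> the case where \<open>t\<close> is the
    pullback \<open>t'\<close> of the left leg of \<open>g\<close>.\<close>
  have abs: "par_map C S s f \<cdot>\<^bsub>?P\<^esub> par_map C S (s \<cdot> t) (s \<cdot> t) = par_map C S (s \<cdot> t) (f \<cdot> t)"
    if "s \<in> S" "f \<in> Arr C" "Dom C s = Dom C f" "t \<in> S" "Cod C t = Dom C s" for s f t
  proof -
    have "par_map C S s f \<cdot>\<^bsub>?P\<^esub> par_map C S (s \<cdot> t) (s \<cdot> t)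
        = ?F f \<cdot>\<^bsub>?P\<^esub> ?R s \<cdot>\<^bsub>?P\<^esub> (?F s \<cdot>\<^bsub>?P\<^esub> ?F t \<cdot>\<^bsub>?P\<^esub> ?R (s \<cdot> t))"
      using FR[of s f] FR[of "s \<cdot> t" "s \<cdot> t"] FF[of t s] that Comp_in_S by simp
    also have "\<dots> = ?F f \<cdot>\<^bsub>?P\<^esub> (?R s \<cdot>\<^bsub>?P\<^esub> (?F s \<cdot>\<^bsub>?P\<^esub> (?F t \<cdot>\<^bsub>?P\<^esub> ?R (s \<cdot> t))))"
      using that Comp_in_S by simp
    also have "\<dots> = ?F f \<cdot>\<^bsub>?P\<^esub> (?F t \<cdot>\<^bsub>?P\<^esub> ?R (s \<cdot> t))"
      using RF[of s "?F t \<cdot>\<^bsub>?P\<^esub> ?R (s \<cdot> t)"] that Comp_in_S by simp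
    also have "\<dots> = (?F f \<cdot>\<^bsub>?P\<^esub> ?F t) \<cdot>\<^bsub>?P\<^esub> ?R (s \<cdot> t)"
      using that Comp_in_S by simp
    also have "\<dots> = par_map C S (s \<cdot> t) (f \<cdot> t)"
      using FF[of t f] FR[of "s \<cdot> t" "f \<cdot> t"] that Comp_in_S by simp
    finally show ?thesis .
  qed
  \<comment> \<open>A single pullback of \<open>s\<close> and \<open>t\<close> yields both
    \<open>R2\<close> and \<open>R3\<close>: its diagonal \<open>s \<cdot> t'\<close> equals
    \<open>t \<cdot> s'\<close>, which is symmetric in the two left legs.\<close>
  have comm: "par_map C S t v \<cdot>\<^bsub>?P\<^esub> par_map C S s s = par_map C S (s \<cdot> t') (v \<cdot> s')"
    if "s \<in> S" "t \<in> S" "v \<in> Arr C" "Dom C t = Dom C v" "is_pullback C s t t' s'" for s t v t' s'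
    using par_map_Comp[of s s t v t' s'] that by simp
  show ?thesis
  proof
    show "Rst ?P f \<in> Hom ?P (Dom ?P f) (Dom ?P f)" if a: "f \<in> Arr ?P" for f
      using that by (auto elim!: Par_ArrE simp: par_map_Rst Hom_def)
    show "f \<cdot>\<^bsub>?P\<^esub> Rst ?P f = f" if a: "f \<in> Arr ?P" for f
    proof -
      obtain s u where f: "s \<in> S" "u \<in> Arr C" "Dom C s = Dom C u" "f = par_map C S s u"
        using a by (rule Par_ArrE)
      then show ?thesis
        using abs[of s u "Ide C (Dom C s)"] by (simp add: par_map_Rst)
    qed
    show "Rst ?P f \<cdot>\<^bsub>?P\<^esub> Rst ?P g = Rst ?P g \<cdot>\<^bsub>?P\<^esub> Rst ?P f"
      and "Rst ?P (g \<cdot>\<^bsub>?P\<^esub> Rst ?P f) = Rst ?P g \<cdot>\<^bsub>?P\<^esub> Rst ?P f"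
      if a: "f \<in> Arr ?P" "g \<in> Arr ?P" "Dom ?P f = Dom ?P g" for f g
    proof -
      obtain s u where f: "s \<in> S" "u \<in> Arr C" "Dom C s = Dom C u" "f = par_map C S s u"
        using a(1) by (rule Par_ArrE)
      obtain t v where g: "t \<in> S" "v \<in> Arr C" "Dom C t = Dom C v" "g = par_map C S t v"
        using a(2) by (rule Par_ArrE)
      obtain t' s' where pb: "is_pullback C s t t' s'"
        using pullback_exists[of t s] f g a(3) by auto
      note D = is_pullbackD[OF pb]
      show "Rst ?P f \<cdot>\<^bsub>?P\<^esub> Rst ?P g = Rst ?P g \<cdot>\<^bsub>?P\<^esub> Rst ?P f"
        using comm[OF f(1) g(1) _ _ pb, of t] comm[OF g(1) f(1) _ _ is_pullback_sym[OF pb], of s]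
          f g D by (simp add: par_map_Rst)
      show "Rst ?P (g \<cdot>\<^bsub>?P\<^esub> Rst ?P f) = Rst ?P g \<cdot>\<^bsub>?P\<^esub> Rst ?P f"
        using comm[OF f(1) g(1) _ _ pb, of t] comm[OF f(1) g(1) _ _ pb, of v]
          f g D by (simp add: par_map_Rst)
    qed
    show "Rst ?P g \<cdot>\<^bsub>?P\<^esub> f = f \<cdot>\<^bsub>?P\<^esub> Rst ?P (g \<cdot>\<^bsub>?P\<^esub> f)"
      if a: "f \<in> Arr ?P" "g \<in> Arr ?P" "Cod ?P f = Dom ?P g" for f g
    proof -
      obtain s u where f: "s \<in> S" "u \<in> Arr C" "Dom C s = Dom C u" "f = par_map C S s u"
        using a(1) by (rule Par_ArrE)
      obtain t v where g: "t \<in> S" "v \<in> Arr C" "Dom C t = Dom C v" "g = par_map C S t v"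
        using a(2) by (rule Par_ArrE)
      obtain t' u' where pb: "is_pullback C u t t' u'"
        using pullback_exists[of t u] f g a(3) by auto
      note D = is_pullbackD[OF pb]
      have "t' \<in> S" using pullback_in_S[OF g(1) pb] .
      then show ?thesis
        using par_map_Comp[OF f(1-3) g(1) _ _ pb, of t] par_map_Comp[OF f(1-3) g(1-3) pb]
          abs[OF f(1-3), of t'] f g D by (simp add: par_map_Rst)
    qed
    show "\<exists>m r. m \<in> Hom ?P (Cod ?P r) (Dom ?P r) \<and> r \<in> Arr ?P \<and> m \<cdot>\<^bsub>?P\<^esub> r = e
        \<and> r \<cdot>\<^bsub>?P\<^esub> m = Ide ?P (Dom ?P m)"
      if a: "e \<in> Arr ?P" "Rst ?P e = e" for e
    proof -
      obtain s u where e: "s \<in> S" "u \<in> Arr C" "Dom C s = Dom C u" "e = par_map C S s u"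
        using a(1) by (rule Par_ArrE)
      have "?F s \<cdot>\<^bsub>?P\<^esub> ?R s = e" using FR[of s s] a(2) e by (simp add: par_map_Rst)
      moreover have "?R s \<cdot>\<^bsub>?P\<^esub> ?F s = Ide ?P (Dom ?P (?F s))"
        using par_map_split[OF e(1)] e by simp
      ultimately show ?thesis
        using e by (intro exI[of _ "?F s"] exI[of _ "?R s"]) (auto simp: Hom_def)
    qed
  qed
qed

end

section \<open>Total maps of a split restriction category\<close>

lemma Total_cat_simps [simp]:
  "Obj (Total_cat X) = Obj X" "Dom (Total_cat X) = Dom X" "Cod (Total_cat X) = Cod X"
  "Ide (Total_cat X) = Ide X" "Comp (Total_cat X) = Comp X"
  "f \<in> Arr (Total_cat X) \<longleftrightarrow> is_total X f"
  by (simp_all add: Total_cat_def)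

text \<open>The choice is harmless for total restricted isomorphisms, where
  \<open>restricted_inverse_unique\<close> leaves only one candidate.\<close>

definition restricted_inverse :: "('o, 'm, 'x) rcat_scheme \<Rightarrow> 'm \<Rightarrow> 'm" where
  "restricted_inverse X i = (SOME j. j \<in> Hom X (Cod X i) (Dom X i) \<and>
     j \<cdot>\<^bsub>X\<^esub> i = Rst X i \<and> i \<cdot>\<^bsub>X\<^esub> j = Rst X j)"

context restriction_category
begin

section \<open>Total maps and restricted inverses\<close>

abbreviation rinv where "rinv \<equiv> restricted_inverse X"

lemma Rst_simps [simp]:
  assumes "f \<in> Arr X"
  shows "Rst X f \<in> Arr X" "Dom X (Rst X f) = Dom X f" "Cod X (Rst X f) = Dom X f"
  using Rst_in_hom[OF assms] by (auto simp: Hom_def)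

declare R1 [simp]

lemma is_totalD: "is_total X f \<Longrightarrow> f \<in> Arr X" "is_total X f \<Longrightarrow> Rst X f = Ide X (Dom X f)"
  by (simp_all add: is_total_def)

lemma is_total_Ide:
  assumes "A \<in> Obj X"
  shows "is_total X (Ide X A)"
proof -
  have "Ide X A \<cdot> Rst X (Ide X A) = Rst X (Ide X A)"
    using assms by (intro Ide_Comp) simp_all
  then show ?thesis using R1[of "Ide X A"] assms by (simp add: is_total_def)
qed

text \<open>Order restriction idempotents by absorption. Totality of \<open>g\<close> turns
  \<open>R4\<close> into \<open>f = f \<cdot> Rst X (g \<cdot> f)\<close>, which places
  \<open>Rst X f\<close> below \<open>Rst X (g \<cdot> f)\<close>; the reverse comparison comes from
  \<open>f \<cdot> Rst X f = f\<close>.\<close>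

lemma Rst_Comp_total:
  assumes "is_total X g" "f \<in> Arr X" "Cod X f = Dom X g"
  shows "Rst X (g \<cdot> f) = Rst X f"
proof -
  note g = is_totalD[OF assms(1)]
  have "f = f \<cdot> Rst X (g \<cdot> f)"
    using R4[OF assms(2) g(1) assms(3)] g assms by simp
  then have "Rst X f = Rst X f \<cdot> Rst X (g \<cdot> f)"
    using R3[of "g \<cdot> f" f] assms g by simp
  also have "\<dots> = Rst X (g \<cdot> f \<cdot> Rst X f)"
    using R2[of f "g \<cdot> f"] R3[of f "g \<cdot> f"] assms g by simp
  also have "\<dots> = Rst X (g \<cdot> f)"
    using assms g by simp
  finally show ?thesis by simp
qed

lemma Rst_Rst [simp]: "f \<in> Arr X \<Longrightarrow> Rst X (Rst X f) = Rst X f"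
  using R3[of f "Ide X (Dom X f)"] is_totalD(2)[OF is_total_Ide[of "Dom X f"]] by simp

lemma is_total_Comp:
  "is_total X f \<Longrightarrow> is_total X g \<Longrightarrow> Cod X f = Dom X g \<Longrightarrow> is_total X (g \<cdot> f)"
  using Rst_Comp_total[of g f] by (simp add: is_total_def)

text \<open>Apply \<open>r\<close> to \<open>m \<cdot> Rst X m = m\<close>.\<close>

lemma is_total_section:
  assumes "m \<in> Arr X" "r \<in> Arr X" "Cod X m = Dom X r" "r \<cdot> m = Ide X (Dom X m)"
  shows "is_total X m"
  using Comp_reassoc[OF assms(4), of "Rst X m"] assms by (simp add: is_total_def)

lemma category_Total: "category (Total_cat X)"
proof
  show "g \<cdot>\<^bsub>Total_cat X\<^esub> f \<in> Hom (Total_cat X) (Dom (Total_cat X) f) (Cod (Total_cat X) g)"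
    if "f \<in> Arr (Total_cat X)" "g \<in> Arr (Total_cat X)" "Cod (Total_cat X) f = Dom (Total_cat X) g" for f g
    using that is_total_Comp is_totalD by (simp add: Hom_def)
qed (auto simp: Hom_def is_total_Ide is_totalD(1))

text \<open>The idempotents \<open>i \<cdot> j\<close> and \<open>i \<cdot> k\<close> absorb each
  other, and they commute by \<open>R2\<close>, so they are equal. Then
  \<open>j = j \<cdot> (i \<cdot> j) = j \<cdot> (i \<cdot> k) = k\<close>.\<close>

lemma restricted_inverse_unique:
  assumes i: "i \<in> Arr X"
    and j: "j \<in> Arr X" "Dom X j = Cod X i" "Cod X j = Dom X i" "j \<cdot> i = Ide X (Dom X i)" "i \<cdot> j = Rst X j"
    and k: "k \<in> Arr X" "Dom X k = Cod X i" "Cod X k = Dom X i" "k \<cdot> i = Ide X (Dom X i)" "i \<cdot> k = Rst X k"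
  shows "j = k"
proof -
  have "Rst X j \<cdot> Rst X k = i \<cdot> (j \<cdot> (i \<cdot> k))"
    using i j(1-3) k(1-3) by (simp flip: j(5) k(5))
  also have "\<dots> = Rst X k"
    using Comp_reassoc[OF j(4), of k] i j(1-3) k by simp
  finally have 1: "Rst X j \<cdot> Rst X k = Rst X k" .
  have "Rst X k \<cdot> Rst X j = i \<cdot> (k \<cdot> (i \<cdot> j))"
    using i j(1-3) k(1-3) by (simp flip: j(5) k(5))
  also have "\<dots> = Rst X j"
    using Comp_reassoc[OF k(4), of j] i j k(1-3) by simp
  finally have eq: "i \<cdot> j = i \<cdot> k"
    using 1 R2[of j k] j k by simp
  have "j = j \<cdot> (i \<cdot> k)"
    using j R1[of j] eq by simp
  also have "\<dots> = k"
    using Comp_reassoc[OF j(4), of k] i j(1-3) k(1-3) by simp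
  finally show ?thesis .
qed

lemma ReIsoI:
  assumes "i \<in> Arr X" "j \<in> Arr X" "Dom X j = Cod X i" "Cod X j = Dom X i"
    "j \<cdot> i = Ide X (Dom X i)" "i \<cdot> j = Rst X j"
  shows "i \<in> ReIso X"
  using is_total_section[of i j] assms
  by (auto simp: ReIso_def is_restricted_iso_def is_total_def Hom_def)

lemma ReIsoD:
  assumes "i \<in> ReIso X"
  shows "is_total X i" "i \<in> Arr X" "rinv i \<in> Arr X" "Dom X (rinv i) = Cod X i" "Cod X (rinv i) = Dom X i"
    "rinv i \<cdot> i = Ide X (Dom X i)" "i \<cdot> rinv i = Rst X (rinv i)"
proof -
  have i: "is_restricted_iso X i" "is_total X i" using assms by (auto simp: ReIso_def)
  then have "\<exists>j. j \<in> Hom X (Cod X i) (Dom X i) \<and> j \<cdot> i = Rst X i \<and> i \<cdot> j = Rst X j"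
    unfolding is_restricted_iso_def by blast
  from someI_ex[OF this] i(2)
  show "is_total X i" "i \<in> Arr X" "rinv i \<in> Arr X" "Dom X (rinv i) = Cod X i" "Cod X (rinv i) = Dom X i"
    "rinv i \<cdot> i = Ide X (Dom X i)" "i \<cdot> rinv i = Rst X (rinv i)"
    by (auto simp: restricted_inverse_def Hom_def is_total_def)
qed

lemma restricted_inverse_eqI:
  assumes "i \<in> Arr X" "j \<in> Arr X" "Dom X j = Cod X i" "Cod X j = Dom X i"
    "j \<cdot> i = Ide X (Dom X i)" "i \<cdot> j = Rst X j"
  shows "rinv i = j"
proof -
  have "i \<in> ReIso X" using assms by (rule ReIsoI)
  note i = ReIsoD[OF this]
  show ?thesis by (rule restricted_inverse_unique[OF i(2) i(3-7) assms(2-6)])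
qed

lemma ReIso_Comp:
  assumes "i \<in> ReIso X" "k \<in> ReIso X" "Cod X i = Dom X k"
  shows "k \<cdot> i \<in> ReIso X" "rinv (k \<cdot> i) = rinv i \<cdot> rinv k"
proof -
  note D = ReIsoD[OF assms(1)] ReIsoD[OF assms(2)]
  let ?j = "rinv i \<cdot> rinv k"
  have 1: "?j \<cdot> (k \<cdot> i) = Ide X (Dom X (k \<cdot> i))"
    using Comp_reassoc[OF D(13), of i] D assms(3) by simp
  \<comment> \<open>The restriction of \<open>rinv i\<close> sits between \<open>k\<close> and
    \<open>rinv k\<close>; \<open>R4\<close> moves it to the right of \<open>rinv k\<close>, after
    which \<open>R2\<close> and \<open>R3\<close> merge the two idempotents.\<close>
  have "k \<cdot> i \<cdot> ?j = k \<cdot> (Rst X (rinv i) \<cdot> rinv k)"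
    using Comp_reassoc[OF D(7), of "rinv k"] D assms(3) by simp
  also have "\<dots> = k \<cdot> (rinv k \<cdot> Rst X ?j)"
    using R4[of "rinv k" "rinv i"] D assms(3) by simp
  also have "\<dots> = Rst X (rinv k) \<cdot> Rst X ?j"
    using Comp_reassoc[OF D(14), of "Rst X ?j"] D assms(3) by simp
  also have "\<dots> = Rst X (?j \<cdot> Rst X (rinv k))"
    using R2[of "rinv k" ?j] R3[of "rinv k" ?j] D assms(3) by simp
  also have "\<dots> = Rst X ?j"
    using D assms(3) by simp
  finally have 2: "k \<cdot> i \<cdot> ?j = Rst X ?j" .
  show "k \<cdot> i \<in> ReIso X"
    by (rule ReIsoI[OF _ _ _ _ 1 2]) (use D assms(3) in auto)
  show "rinv (k \<cdot> i) = ?j"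
    by (rule restricted_inverse_eqI[OF _ _ _ _ 1 2]) (use D assms(3) in auto)
qed

lemma is_iso_Total:
  assumes "is_iso (Total_cat X) x"
  shows "x \<in> ReIso X" "x \<cdot> rinv x = Ide X (Cod X x)"
proof -
  interpret T: category "Total_cat X" by (rule category_Total)
  obtain y where y: "is_total X x" "is_total X y" "Dom X y = Cod X x" "Cod X y = Dom X x"
    "y \<cdot> x = Ide X (Dom X x)" "x \<cdot> y = Ide X (Cod X x)"
    using T.is_isoE[OF assms] by auto
  have eq: "x \<cdot> y = Rst X y" using y is_totalD by simp
  show "x \<in> ReIso X"
    by (rule ReIsoI[OF _ _ y(3-5) eq]) (use y is_totalD in auto)
  have "rinv x = y"
    by (rule restricted_inverse_eqI[OF _ _ y(3-5) eq]) (use y is_totalD in auto)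
  then show "x \<cdot> rinv x = Ide X (Cod X x)" using y by simp
qed

lemma Ide_ReIso:
  assumes "A \<in> Obj X"
  shows "Ide X A \<in> ReIso X" "rinv (Ide X A) = Ide X A"
  using ReIsoI[of "Ide X A" "Ide X A"] restricted_inverse_eqI[of "Ide X A" "Ide X A"]
    is_totalD(2)[OF is_total_Ide[OF assms]] assms by auto

text \<open>The restricted inverse is a left inverse, so \<open>v\<close> is monic in all of
  \<open>X\<close>, not only against total maps. Cancelling in front of restrictions that are not
  yet known to be identities relies on this.\<close>

lemma ReIso_cancel:
  assumes "v \<in> ReIso X" "a \<in> Arr X" "b \<in> Arr X" "Cod X a = Dom X v" "Cod X b = Dom X v" "v \<cdot> a = v \<cdot> b"
  shows "a = b"
proof -
  note D = ReIsoD[OF assms(1)]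
  have "rinv v \<cdot> (v \<cdot> c) = c" if "c \<in> Arr X" "Cod X c = Dom X v" for c
    using Comp_reassoc[OF D(6), of c] D that by simp
  then show ?thesis using assms by metis
qed

text \<open>A morphism \<open>v\<close> of cospans is monic when it lies in \<^term>\<open>ReIso X\<close>, so the pullbacks of its
  source and of its target coincide.\<close>

lemma S_star_Total_iso:
  assumes "x \<in> S_star (Total_cat X) (ReIso X)"
  shows "is_iso (Total_cat X) x"
proof -
  let ?T = "Total_cat X"
  interpret T: category ?T by (rule category_Total)
  obtain A B f s g t v w h y where
    fs: "(f, s) \<in> cospans ?T (ReIso X) A B" and gt: "(g, t) \<in> cospans ?T (ReIso X) A B"
    and mor: "cospan_mor ?T v (f, s) (g, t)" and v: "v \<in> ReIso X"
    and conj: "is_conjugate ?T (f, s) (g, t) w" and x: "is_pullback ?T h w x y"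
    using assms unfolding S_star_def by auto
  obtain s' f' t' g' where pb: "is_pullback ?T f s s' f'" and pb': "is_pullback ?T g t t' g'"
    and w: "is_total X w" "Dom X w = Dom X s'" "Cod X w = Dom X t'" "t' \<cdot> w = s'" "g' \<cdot> w = f'"
    using conj by (auto simp: is_conjugate_def Hom_def)
  have vfs: "v \<cdot> f = g" "v \<cdot> s = t" "Dom X v = Cod X s"
    using mor by (auto simp: cospan_mor_def Hom_def)
  note D = T.is_pullbackD[OF pb, simplified] T.is_pullbackD[OF pb', simplified]
  note A = D(1-4,10-13)[THEN is_totalD(1)] w(1)[THEN is_totalD(1)] ReIsoD(2)[OF v]
  have "v \<cdot> (f \<cdot> t') = v \<cdot> (s \<cdot> g')"
    using Comp_reassoc[OF vfs(1), of t'] Comp_reassoc[OF vfs(2), of g'] A D vfs(3)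
      fs gt by (simp add: cospans_def)
  then have "f \<cdot> t' = s \<cdot> g'"
    by (rule ReIso_cancel[OF v, rotated -1]) (use A D vfs(3) fs gt in \<open>auto simp: cospans_def\<close>)
  \<comment> \<open>This \<open>u\<close> is the inverse of the conjugate \<open>w\<close>; then
    \<open>x\<close>, being a pullback of \<open>w\<close>, is invertible too.\<close>
  then obtain u where u: "is_total X u" "Dom X u = Dom X t'" "Cod X u = Dom X s'"
      "s' \<cdot> u = t'" "f' \<cdot> u = g'"
    using T.is_pullback_lift[OF pb, of t' g'] D fs gt by (auto simp: cospans_def)
  note uA = is_totalD(1)[OF u(1)]
  have "w \<cdot> u = Ide X (Dom X t')"
    using T.is_pullback_unique[OF pb', of "w \<cdot> u" "Ide X (Dom X t')"] is_total_Comp[OF u(1) w(1)]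
      Comp_reassoc[OF w(4), of u] Comp_reassoc[OF w(5), of u] is_total_Ide[of "Dom X t'"] u(2-5) w(2,3) uA A D
    by simp
  moreover have "u \<cdot> w = Ide X (Dom X s')"
    using T.is_pullback_unique[OF pb, of "u \<cdot> w" "Ide X (Dom X s')"] is_total_Comp[OF w(1) u(1)]
      Comp_reassoc[OF u(4), of w] Comp_reassoc[OF u(5), of w] is_total_Ide[of "Dom X s'"] u(2,3) w(2-5) uA A D
    by simp
  ultimately have "is_iso ?T w"
    using u w by (intro T.is_isoI[of w u]) auto
  then show ?thesis by (rule T.is_pullback_of_iso[OF x])
qed

end

section \<open>Stable structure on the total maps\<close>

context split_restriction_category
begin

text \<open>The last conclusion says how the second leg is tied to the restricted inverses; it is
  what makes the comparison with \<open>X\<close> preserve composition.\<close>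

lemma Total_pullback:
  assumes s: "s \<in> ReIso X" and f: "is_total X f" and "Cod X f = Cod X s"
  obtains m f' where "m \<in> ReIso X" "is_pullback (Total_cat X) f s m f'" "f' \<cdot> rinv m = rinv s \<cdot> f"
proof -
  interpret T: category "Total_cat X" by (rule category_Total)
  note S = ReIsoD[OF s]
  note F = is_totalD[OF f]
  let ?e = "Rst X (rinv s \<cdot> f)"
  obtain m r where m: "m \<in> Arr X" "r \<in> Arr X" "Dom X m = Cod X r" "Cod X m = Dom X r"
      "m \<cdot> r = ?e" "r \<cdot> m = Ide X (Dom X m)"
    using split[of ?e] S F assms(3) by (auto simp: Hom_def)
  have "Dom X r = Dom X (m \<cdot> r)" using m(1-4) by simp
  also have "\<dots> = Dom X f" using S F assms(3) by (simp add: m(5))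
  finally have Dr: "Dom X r = Dom X f" .
  have mt: "is_total X m" using is_total_section[of m r] m by simp
  \<comment> \<open>Since \<open>m\<close> is total, \<open>r\<close> has the same restriction as
    \<open>m \<cdot> r\<close>, which makes \<open>r\<close> the restricted inverse of
    \<open>m\<close>.\<close>
  have "Rst X r = Rst X ?e" using Rst_Comp_total[OF mt, of r] m by simp
  then have er: "m \<cdot> r = Rst X r" using m S F assms(3) by simp
  have mI: "m \<in> ReIso X" "rinv m = r"
    using ReIsoI[of m r] restricted_inverse_eqI[of m r] m er by simp_all
  let ?f' = "rinv s \<cdot> f \<cdot> m"
  have A: "rinv s \<cdot> f \<in> Arr X" "?f' \<in> Arr X" "Dom X ?f' = Dom X m" "Cod X ?f' = Dom X s" "rinv s \<cdot> f \<cdot> m = rinv s \<cdot> (f \<cdot> m)"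
    using S F m Dr assms(3) by simp_all
  have em: "?e \<cdot> m = m"
    using Comp_assoc[of m r m] m by simp
  \<comment> \<open>By \<open>R4\<close> the left side equals \<open>?e \<cdot> m\<close>, which is
    \<open>m\<close>; cancelling \<open>m\<close> makes \<open>?f'\<close> total.\<close>
  have "m \<cdot> Rst X ?f' = m \<cdot> Ide X (Dom X m)"
    using R4[of m "rinv s \<cdot> f"] em A m Dr S F assms(3) by simp
  then have "Rst X ?f' = Ide X (Dom X m)"
    by (rule ReIso_cancel[OF mI(1), rotated -1]) (use A m in simp_all)
  then have f't: "is_total X ?f'"
    using A(2,3) by (simp add: is_total_def)
  have "s \<cdot> ?f' = (s \<cdot> rinv s) \<cdot> f \<cdot> m"
    using S(1-5) F m Dr assms(3) by simp
  also have "\<dots> = f \<cdot> ?e \<cdot> m"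
    using R4[of f "rinv s"] S F assms(3) by simp
  finally have sq: "f \<cdot> m = s \<cdot> ?f'"
    using em A m F Dr S assms(3) by simp
  have "is_pullback (Total_cat X) f s m ?f'"
  proof (rule T.is_pullbackI; unfold Total_cat_simps)
    fix a b assume ab: "is_total X a" "is_total X b" "Dom X a = Dom X b" "Cod X a = Dom X f"
      "Cod X b = Dom X s" "f \<cdot> a = s \<cdot> b"
    note AB = is_totalD[OF ab(1)] is_totalD[OF ab(2)]
    have b: "rinv s \<cdot> (f \<cdot> a) = b"
      using Comp_reassoc[OF S(6), of b] ab AB S by simp
    \<comment> \<open>The lift of the cone is \<open>r \<cdot> a\<close>. It works because
      \<open>rinv s \<cdot> f \<cdot> a\<close> is the total map \<open>b\<close>, so by
      \<open>R4\<close> the idempotent \<open>?e\<close> fixes \<open>a\<close>.\<close>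
    have "m \<cdot> (r \<cdot> a) = ?e \<cdot> a"
      using Comp_reassoc[OF m(5), of a] m ab AB Dr by simp
    also have "\<dots> = a"
      using R4[of a "rinv s \<cdot> f"] A b ab AB S F assms(3) by simp
    finally have u: "m \<cdot> (r \<cdot> a) = a" .
    moreover have "is_total X (r \<cdot> a)"
      using Rst_Comp_total[OF mt, of "r \<cdot> a"] u m Dr ab AB by (simp add: is_total_def)
    moreover have "?f' \<cdot> (r \<cdot> a) = b"
      using u b A m Dr ab(1-5) AB S F assms(3) by simp
    ultimately show "\<exists>u \<in> Arr (Total_cat X). Dom X u = Dom X a \<and> Cod X u = Dom X m \<and> m \<cdot> u = a \<and> ?f' \<cdot> u = b"
      using m Dr ab AB by (intro bexI[of _ "r \<cdot> a"]) auto
  next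
    fix u v assume "is_total X u" "is_total X v" "Dom X u = Dom X v" "Cod X u = Dom X m"
      "Cod X v = Dom X m" "m \<cdot> u = m \<cdot> v"
    then show "u = v" using ReIso_cancel[OF mI(1)] is_totalD by blast
  qed (rule sq | simp add: f mt f't S(1) m(4) Dr A(3,4) assms(3))+
  moreover have "?f' \<cdot> r = rinv s \<cdot> f \<cdot> (m \<cdot> r)"
    by (rule Comp_assoc) (use A m Dr S F assms(3) in simp_all)
  then have "?f' \<cdot> r = rinv s \<cdot> f"
    unfolding m(5) R1[OF A(1)] .
  ultimately show thesis using that mI by blast
qed

theorem stably_structured_Total: "stably_structured (Total_cat X) (ReIso X)"
proof -
  let ?T = "Total_cat X"
  interpret T: category ?T by (rule category_Total)
  show ?thesis
  proof
    show "ReIso X \<subseteq> Arr ?T" by (auto simp: ReIso_def)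
    show "f \<in> ReIso X" if "is_iso ?T f" for f using is_iso_Total that by blast
    show "t \<cdot>\<^bsub>?T\<^esub> s \<in> ReIso X" if "s \<in> ReIso X" "t \<in> ReIso X" "Cod ?T s = Dom ?T t" for s t
      using ReIso_Comp that by simp
    show "\<exists>s' f'. is_pullback ?T f s s' f'" if "s \<in> ReIso X" "f \<in> Arr ?T" "Cod ?T f = Cod ?T s" for s f
    proof -
      have "is_total X f" "Cod X f = Cod X s" using that by auto
      from Total_pullback[OF that(1) this] show ?thesis by blast
    qed
    show "s' \<in> ReIso X" if s: "s \<in> ReIso X" and pb: "is_pullback ?T f s s' f'" for s f s' f'
    proof -
      have "is_total X f" "Cod X f = Cod X s" using T.is_pullbackD[OF pb] by auto
      then obtain m g where m: "m \<in> ReIso X" "is_pullback ?T f s m g"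
        using Total_pullback[OF s] by blast
      \<comment> \<open>An arbitrary pullback differs from the constructed one by an isomorphism,
        which is itself in \<open>ReIso X\<close>.\<close>
      obtain u where "is_iso ?T u" "Cod X u = Dom X m" "m \<cdot> u = s'"
        using T.is_pullback_iso_unique[OF m(2) pb] by auto
      then show ?thesis using ReIso_Comp(1)[of u m] is_iso_Total m by auto
    qed
  qed
qed

end

section \<open>Recovering a split restriction category from its total maps\<close>

text \<open>The inverse bijections form a restriction functor automatically: each law is checked
  after applying \<open>G1\<close> or \<open>G0\<close>. The functor goes from \<open>Y\<close> to
  \<open>X\<close> because the explicit formula available below maps spans to arrows.\<close>

lemma rcat_isomorphicI:
  fixes X :: "('o, 'm, 'x) rcat_scheme" and Y :: "('p, 'n, 'y) rcat_scheme"
  assumes "restriction_functor Y X G0 G1" "bij_betw G0 (Obj Y) (Obj X)" "bij_betw G1 (Arr Y) (Arr X)"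
  shows "rcat_isomorphic X Y"
proof -
  interpret G: restriction_functor Y X G0 G1 by fact
  define F0 where "F0 = inv_into (Obj Y) G0"
  define F1 where "F1 = inv_into (Arr Y) G1"
  have F0: "F0 A \<in> Obj Y" "G0 (F0 A) = A" if "A \<in> Obj X" for A
    using that assms(2) bij_betw_inv_into_right[OF assms(2)] bij_betwE[OF bij_betw_inv_into[OF assms(2)]]
    by (auto simp: F0_def)
  have F1: "F1 f \<in> Arr Y" "G1 (F1 f) = f" if "f \<in> Arr X" for f
    using that assms(3) bij_betw_inv_into_right[OF assms(3)] bij_betwE[OF bij_betw_inv_into[OF assms(3)]]
    by (auto simp: F1_def)
  have FG0: "F0 (G0 B) = B" if "B \<in> Obj Y" for B
    using that bij_betw_inv_into_left[OF assms(2)] by (simp add: F0_def)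
  have FG1: "F1 (G1 g) = g" if "g \<in> Arr Y" for g
    using that bij_betw_inv_into_left[OF assms(3)] by (simp add: F1_def)
  have hom: "F1 f \<in> Arr Y" "Dom Y (F1 f) = F0 (Dom X f)" "Cod Y (F1 f) = F0 (Cod X f)"
    if "f \<in> Arr X" for f
  proof -
    show "F1 f \<in> Arr Y" using F1 that by blast
    have "G0 (Dom Y (F1 f)) = Dom X f" "G0 (Cod Y (F1 f)) = Cod X f"
      using G.F1_hom[of "F1 f"] F1[OF that] by (auto simp: Hom_def)
    then show "Dom Y (F1 f) = F0 (Dom X f)" "Cod Y (F1 f) = F0 (Cod X f)"
      using FG0[of "Dom Y (F1 f)"] FG0[of "Cod Y (F1 f)"] F1[OF that] by auto
  qed
  have "restriction_functor X Y F0 F1"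
  proof
    show "F0 A \<in> Obj Y" if "A \<in> Obj X" for A using F0 that by blast
    show "F1 f \<in> Hom Y (F0 (Dom X f)) (F0 (Cod X f))" if "f \<in> Arr X" for f
      using hom that by (simp add: Hom_def)
    show "F1 (Ide X A) = Ide Y (F0 A)" if "A \<in> Obj X" for A
      using FG1[of "Ide Y (F0 A)"] G.F1_Id[of "F0 A"] F0[OF that] by simp
    show "F1 (g \<cdot>\<^bsub>X\<^esub> f) = F1 g \<cdot>\<^bsub>Y\<^esub> F1 f" if "f \<in> Arr X" "g \<in> Arr X" "Cod X f = Dom X g" for f g
      using FG1[of "F1 g \<cdot>\<^bsub>Y\<^esub> F1 f"] G.F1_Comp[of "F1 f" "F1 g"] F1 hom that by simp
    show "F1 (Rst X f) = Rst Y (F1 f)" if "f \<in> Arr X" for f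
      using FG1[of "Rst Y (F1 f)"] G.F1_Rst[of "F1 f"] F1 that by simp
  qed
  then show ?thesis
    unfolding rcat_isomorphic_def using assms(1) F0 F1 FG0 FG1 by blast
qed

section \<open>The isomorphism given by composing with the restricted inverse\<close>

context split_restriction_category
begin

theorem rcat_isomorphic_Par_Total: "rcat_isomorphic X (Par (Total_cat X) (ReIso X))"
proof -
  let ?T = "Total_cat X" and ?I = "ReIso X"
  let ?P = "Par ?T ?I"
  interpret T: stably_structured ?T ?I by (rule stably_structured_Total)
  interpret P: split_restriction_category ?P by (rule T.split_restriction_category_Par)
  have step_eq: "f \<cdot> rinv s = g \<cdot> rinv t" if st: "span_step ?T ?I (s, f) (t, g)" for s f t g
  proof -
    have D: "s \<in> ?I" "t \<in> ?I" "is_total X g" "Dom X t = Dom X g"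
      using st by (auto simp: span_step_def spans_def)
    obtain x where x: "x \<in> S_star ?T ?I" "is_total X x" "Cod X x = Dom X t" "t \<cdot> x = s" "g \<cdot> x = f"
      using T.span_stepE[OF st] by auto
    \<comment> \<open>Since \<open>x\<close> is invertible, \<open>x \<cdot> rinv x\<close> is an
      identity and drops out of \<open>g \<cdot> x \<cdot> rinv x \<cdot> rinv t\<close>.\<close>
    have "is_iso ?T x" using x(1) by (rule S_star_Total_iso)
    note xI = is_iso_Total[OF this]
    have "rinv s = rinv x \<cdot> rinv t"
      using ReIso_Comp(2)[OF xI(1) D(2)] x by simp
    then show ?thesis
      using Comp_reassoc[OF xI(2), of "rinv t"] x(3) ReIsoD[OF xI(1)] ReIsoD[OF D(2)] D is_totalD[OF D(3)]
      by (simp flip: x(5))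
  qed
  have equiv: "snd p \<cdot> rinv (fst p) = snd q \<cdot> rinv (fst q)" if "equivclp (span_step ?T ?I) p q" for p q
    using that
  proof (induction rule: equivclp_induct)
    case (step y z)
    then show ?case
      using step_eq[of "fst y" "snd y" "fst z" "snd z"] step_eq[of "fst z" "snd z" "fst y" "snd y"]
      by auto
  qed simp
  \<comment> \<open>The value is read off an arbitrary representative of the class \<open>K\<close>;
    by \<open>equiv\<close> all representatives give the same one.\<close>
  define G where "G = (\<lambda>(A :: 'o, B :: 'o, K). SOME h. \<exists>p \<in> K. h = snd p \<cdot> rinv (fst p))"
  have G: "G (par_map ?T ?I s f) = f \<cdot> rinv s" for s f
  proof -
    let ?K = "span_class ?T ?I (s, f)"
    have "(s, f) \<in> ?K" by (simp add: span_class_def)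
    then have "\<exists>h. \<exists>p \<in> ?K. h = snd p \<cdot> rinv (fst p)" by blast
    from someI_ex[OF this] have "\<exists>p \<in> ?K. G (par_map ?T ?I s f) = snd p \<cdot> rinv (fst p)"
      by (simp add: G_def par_map_def)
    then show ?thesis using equiv[of "(s, f)"] by (force simp: span_class_def)
  qed
  have Rst_G: "Rst X (f \<cdot> rinv s) = s \<cdot> rinv s" if "s \<in> ?I" "is_total X f" "Dom X s = Dom X f" for s f
    using Rst_Comp_total[of f "rinv s"] ReIsoD[OF that(1)] that by simp
  have G_functor: "restriction_functor ?P X (\<lambda>A. A) G"
  proof
    show "G a \<in> Hom X (Dom ?P a) (Cod ?P a)" if a: "a \<in> Arr ?P" for a
    proof -
      obtain s f where "s \<in> ?I" "is_total X f" "Dom X s = Dom X f" "a = par_map ?T ?I s f"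
        using T.Par_ArrE[OF a] by auto
      then show ?thesis using ReIsoD[of s] is_totalD[of f] by (simp add: G Hom_def)
    qed
    show "G (Ide ?P A) = Ide X A" if "A \<in> Obj ?P" for A
      using that Ide_ReIso[of A] by (simp add: G)
    show "G (b \<cdot>\<^bsub>?P\<^esub> a) = G b \<cdot> G a" if a: "a \<in> Arr ?P" and b: "b \<in> Arr ?P" and ab: "Cod ?P a = Dom ?P b" for a b
    proof -
      obtain s f where sf: "s \<in> ?I" "is_total X f" "Dom X s = Dom X f" "a = par_map ?T ?I s f"
        using T.Par_ArrE[OF a] by auto
      obtain t g where tg: "t \<in> ?I" "is_total X g" "Dom X t = Dom X g" "b = par_map ?T ?I t g"
        using T.Par_ArrE[OF b] by auto
      have cod: "Cod X f = Cod X t" using ab sf tg by simp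
      obtain m f' where m: "m \<in> ?I" "is_pullback ?T f t m f'" "f' \<cdot> rinv m = rinv t \<cdot> f"
        using Total_pullback[OF tg(1) sf(2) cod] .
      note pb = T.is_pullbackD[OF m(2), simplified]
      note A = is_totalD(1)[OF sf(2)] is_totalD(1)[OF tg(2)] is_totalD(1)[OF pb(4)]
        ReIsoD(2-5)[OF sf(1)] ReIsoD(2-5)[OF tg(1)] ReIsoD(2-5)[OF m(1)]
      have "G (b \<cdot>\<^bsub>?P\<^esub> a) = g \<cdot> f' \<cdot> rinv (s \<cdot> m)"
        using T.par_map_Comp[of s f t g m f'] sf tg m(2) by (simp add: G)
      also have "\<dots> = g \<cdot> (f' \<cdot> (rinv m \<cdot> rinv s))"
        using ReIso_Comp(2)[OF m(1) sf(1)] A sf tg pb by simp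
      also have "\<dots> = g \<cdot> (rinv t \<cdot> (f \<cdot> rinv s))"
        using Comp_reassoc[OF m(3), of "rinv s"] A sf(1-3) tg(1-3) pb by simp
      also have "\<dots> = G b \<cdot> G a"
        using A sf tg cod by (simp add: G)
      finally show ?thesis .
    qed
    show "G (Rst ?P a) = Rst X (G a)" if a: "a \<in> Arr ?P" for a
    proof -
      obtain s f where "s \<in> ?I" "is_total X f" "Dom X s = Dom X f" "a = par_map ?T ?I s f"
        using T.Par_ArrE[OF a] by auto
      then show ?thesis using Rst_G by (simp add: G T.par_map_Rst)
    qed
  qed simp
  have inj: "inj_on G (Arr ?P)"
  proof
    fix a b assume a: "a \<in> Arr ?P" and b: "b \<in> Arr ?P" and eq: "G a = G b"
    obtain s f where sf: "s \<in> ?I" "is_total X f" "Dom X s = Dom X f" "a = par_map ?T ?I s f"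
      using T.Par_ArrE[OF a] by auto
    obtain t g where tg: "t \<in> ?I" "is_total X g" "Dom X t = Dom X g" "b = par_map ?T ?I t g"
      using T.Par_ArrE[OF b] by auto
    note A = is_totalD(1)[OF sf(2)] is_totalD(1)[OF tg(2)] ReIsoD(2-5)[OF sf(1)] ReIsoD(2-5)[OF tg(1)]
    have fg: "f \<cdot> rinv s = g \<cdot> rinv t" using eq sf tg by (simp add: G)
    have st: "s \<cdot> rinv s = t \<cdot> rinv t" using fg Rst_G[of s f] Rst_G[of t g] sf tg by simp
    have cod: "Cod X s = Cod X t" "Cod X f = Cod X g"
      using arg_cong[OF fg, of "Dom X"] arg_cong[OF fg, of "Cod X"] A sf tg by simp_all
    \<comment> \<open>By \<open>st\<close> the maps \<open>s\<close> and \<open>t\<close> split the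
      same idempotent, so these comparison maps between their domains are mutually inverse.\<close>
    let ?x = "rinv t \<cdot> s" and ?y = "rinv s \<cdot> t"
    have sc: "rinv s \<cdot> (s \<cdot> h) = h" if "h \<in> Arr X" "Cod X h = Dom X s" for h
      using Comp_reassoc[OF ReIsoD(6)[OF sf(1)], of h] A that by simp
    have tc: "rinv t \<cdot> (t \<cdot> h) = h" if "h \<in> Arr X" "Cod X h = Dom X t" for h
      using Comp_reassoc[OF ReIsoD(6)[OF tg(1)], of h] A that by simp
    have swap: "s \<cdot> (rinv s \<cdot> h) = t \<cdot> (rinv t \<cdot> h)" if "h \<in> Arr X" "Cod X h = Cod X s" for h
      using Comp_reassoc[OF st, of h] A that cod by simp
    have xA: "?x \<in> Arr X" "?y \<in> Arr X" "Dom X ?x = Dom X s" "Cod X ?x = Dom X t" "Dom X ?y = Dom X t" "Cod X ?y = Dom X s"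
      using A cod by simp_all
    have tx: "t \<cdot> ?x = s"
      using swap[of s] ReIsoD(6)[OF sf(1)] A by simp
    have sy: "s \<cdot> ?y = t"
      using swap[of t] ReIsoD(6)[OF tg(1)] A cod by simp
    have yx: "?y \<cdot> ?x = Ide X (Dom X s)"
      using tx ReIsoD(6)[OF sf(1)] A cod xA by simp
    have xy: "?x \<cdot> ?y = Ide X (Dom X t)"
      using sy ReIsoD(6)[OF tg(1)] A cod xA by simp
    have "is_iso ?T ?x"
      using is_total_section[OF xA(1,2)] is_total_section[OF xA(2,1)] xA yx xy
      by (intro T.is_isoI[of ?x ?y]) simp_all
    moreover have "g \<cdot> ?x = f"
      using Comp_reassoc[OF fg[symmetric], of s] ReIsoD(6)[OF sf(1)] A cod sf tg by simp
    then have "span_mor ?T ?x (s, f) (t, g)"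
      using is_total_section[OF xA(1,2)] xA yx tx by (simp add: span_mor_def Hom_def)
    ultimately have "span_step ?T ?I (s, f) (t, g)"
      using sf tg cod unfolding span_step_def by (intro exI[of _ "Cod X s"] exI[of _ "Cod X f"] exI[of _ ?x]) simp
    then show "a = b" using T.par_map_eqI sf tg by simp
  qed
  have "h \<in> G ` Arr ?P" if h: "h \<in> Arr X" for h
  proof -
    \<comment> \<open>The preimage of \<open>h\<close> is the span \<open>(m, h \<cdot> m)\<close>:
      it is sent to \<open>h \<cdot> m \<cdot> r\<close>, which is \<open>h \<cdot> Rst X h\<close>,
      that is, \<open>h\<close>.\<close>
    obtain m r where m: "m \<in> Arr X" "r \<in> Arr X" "Dom X m = Cod X r" "Cod X m = Dom X r"
        "m \<cdot> r = Rst X h" "r \<cdot> m = Ide X (Dom X m)"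
      using split[of "Rst X h"] h by (auto simp: Hom_def)
    have "Dom X r = Dom X (m \<cdot> r)" using m(1-4) by simp
    also have "\<dots> = Dom X h" using h by (simp add: m(5))
    finally have Dr: "Dom X r = Dom X h" .
    have mt: "is_total X m" using is_total_section[of m r] m by simp
    have "m \<cdot> r = Rst X r" using Rst_Comp_total[OF mt, of r] m h by simp
    then have mI: "m \<in> ?I" "rinv m = r"
      using ReIsoI[of m r] restricted_inverse_eqI[of m r] m by simp_all
    have "Rst X h \<cdot> m = m"
      using Comp_assoc[of m r m] m by simp
    then have "m \<cdot> Rst X (h \<cdot> m) = m \<cdot> Ide X (Dom X m)"
      using R4[of m h] m h Dr by simp
    then have "Rst X (h \<cdot> m) = Ide X (Dom X m)"
      by (rule ReIso_cancel[OF mI(1), rotated -1]) (use m h Dr in simp_all)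
    then have "is_total X (h \<cdot> m)" using m h Dr by (simp add: is_total_def)
    then have "par_map ?T ?I m (h \<cdot> m) \<in> Arr ?P" using mI m h Dr by (intro T.Par_Arr) simp_all
    moreover have "G (par_map ?T ?I m (h \<cdot> m)) = h"
      using mI m h Dr R1[OF h] by (simp add: G)
    ultimately show ?thesis by (metis imageI)
  qed
  moreover have "G a \<in> Arr X" if "a \<in> Arr ?P" for a
    using restriction_functor.F1_hom[OF G_functor that] by (simp add: Hom_def)
  ultimately have "bij_betw G (Arr ?P) (Arr X)" using inj by (auto simp: bij_betw_def)
  then show ?thesis
    by (intro rcat_isomorphicI[OF G_functor]) (simp_all add: bij_betw_def)
qed

end

theorem corollary5:
  fixes C :: "('o, 'm) cat" and S :: "'m set"
  assumes "stably_structured C S"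
  shows "stably_structured (Total_cat (Par C S)) (ReIso (Par C S)) \<and>
    rcat_isomorphic (Par C S) (Par (Total_cat (Par C S)) (ReIso (Par C S)))"
proof -
  interpret split_restriction_category "Par C S"
    using assms by (rule stably_structured.split_restriction_category_Par)
  show ?thesis using stably_structured_Total rcat_isomorphic_Par_Total by blast
qed

end
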